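(* Let $d\ge 4$ and let $\mu$ be a compactly supported Borel probability measure on $\mathbb{R}^d$. (1) $\dim_{\mathrm H} D_x(\operatorname{supp}\mu)\ge\min\left\{\dim_{\mathrm S}\mu-\frac d2,\,1\right\}$ for $\mu$-almost all $x$. (2) $\dim_{\mathrm H} D_x(\operatorname{supp}\mu)\ge\min\left\{\dim_{\mathrm F}^{1/2}\mu-\frac d4,\,1\right\}$ for $\mu$-almost all $x$. (3) $\dim_{\mathrm H} D_x(\operatorname{supp}\mu)\ge\min\left\{\frac{\dim_{\mathrm F}\mu}{2},\,1\right\}$ for $\mu$-almost all $x$.
   Context: For $E\subseteq\mathbb{R}^d$ and $x\in\mathbb{R}^d$, $D_x(E)=\{|x-y|:y\in E\}$ is the pinned distance set; $\dim_{\mathrm H}$ is Hausdorff dimension. For a finite Borel measure $\mu$ on $\mathbb{R}^d$, $\widehat\mu(z)=\int e^{-2\pi i z\cdot x}\,d\mu(x)$. For $s\ge 0$ define $$\mathcal{J}_{s,\theta}(\mu)=\left(\int_{\mathbb{R}^d}|\widehat\mu(z)|^{2/\theta}|z|^{s/\theta-d}\,dz\right)^{\theta}\ (\theta\in(0,1]),\qquad \mathcal{J}_{s,0}(\mu)=\sup_{z\in\mathbb{R}^d}|\widehat\mu(z)|^2|z|^s.$$ The Fourier spectrum of $\mu$ at $\theta\in[0,1]$ is $\dim_{\mathrm F}^{\theta}\mu=\sup\{s\ge 0:\mathcal{J}_{s,\theta}(\mu)<\infty\}$ (with $\sup\emptyset=0$). The Fourier dimension is $\dim_{\mathrm F}\mu=\dim_{\mathrm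 F}^{0}\mu$ and the Sobolev dimension is $\dim_{\mathrm S}\mu=\dim_{\mathrm F}^{1}\mu$, i.e. $\dim_{\mathrm S}\mu=\sup\{s\ge0:\int|\widehat\mu(z)|^2|z|^{s-d}\,dz<\infty\}$. *)

theory Defs
  imports "HOL-Probability.Probability"
begin

text \<open>Real powers of nonnegative numbers with \<open>0 ^ 0 = 1\<close> (whereas \<open>0 powr 0 = 0\<close>).\<close>

definition rpow :: "real \<Rightarrow> real \<Rightarrow> real" where
  "rpow x s = (if s = 0 then 1 else x powr s)"

text \<open>Hausdorff measures and dimension. The sets of a cover are required to be bounded since
  \<^const>\<open>diameter\<close> is meaningless on unbounded sets. Empty sets, which allow for finite
  covers, contribute nothing even if \<open>s = 0\<close>.\<close>

definition hausdorff_weight :: "real \<Rightarrow> 'a::metric_space set \<Rightarrow> ennreal" where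
  "hausdorff_weight s U = (if U = {} then 0 else ennreal (rpow (diameter U) s))"

definition hausdorff_premeasure :: "real \<Rightarrow> real \<Rightarrow> 'a::metric_space set \<Rightarrow> ennreal" where
  "hausdorff_premeasure \<delta> s E =
     (INF U \<in> {U :: nat \<Rightarrow> 'a set. E \<subseteq> (\<Union>i. U i) \<and> (\<forall>i. bounded (U i) \<and> diameter (U i) \<le> \<delta>)}.
        \<Sum>i. hausdorff_weight s (U i))"

definition hausdorff_measure :: "real \<Rightarrow> 'a::metric_space set \<Rightarrow> ennreal" where
  "hausdorff_measure s E = (SUP \<delta>\<in>{0<..}. hausdorff_premeasure \<delta> s E)"

definition hausdorff_dim :: "'a::metric_space set \<Rightarrow> ereal" where
  "hausdorff_dim E = Inf {ereal s | s. s \<ge> 0 \<and> hausdorff_measure s E = 0}"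

definition pinned_distance_set :: "'a::metric_space \<Rightarrow> 'a set \<Rightarrow> real set" where
  "pinned_distance_set x E = {dist x y | y. y \<in> E}"

definition measure_supp :: "'a::topological_space measure \<Rightarrow> 'a set" where
  "measure_supp \<mu> = {x. \<forall>U. open U \<and> x \<in> U \<longrightarrow> emeasure \<mu> U > 0}"

definition fourier_measure :: "'a::euclidean_space measure \<Rightarrow> 'a \<Rightarrow> complex" where
  "fourier_measure \<mu> z = (\<integral>x. cis (- (2 * pi * (z \<bullet> x))) \<partial>\<mu>)"

text \<open>The \<open>\<theta>\<close>-th power of an extended nonnegative number, for \<open>\<theta> > 0\<close>.\<close>

definition ennpow :: "ennreal \<Rightarrow> real \<Rightarrow> ennreal" where
  "ennpow a \<theta> = (if a = \<infinity> then \<infinity> else ennreal (enn2real a powr \<theta>))"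

text \<open>The energy is extended-real valued. In the case \<open>\<theta> > 0\<close> the value of the integrand at
  the single point \<open>z = 0\<close> is irrelevant.\<close>

definition fourier_energy :: "real \<Rightarrow> real \<Rightarrow> 'a::euclidean_space measure \<Rightarrow> ennreal" where
  "fourier_energy s \<theta> \<mu> =
     (if \<theta> = 0 then (SUP z. ennreal ((cmod (fourier_measure \<mu> z))\<^sup>2 * rpow (norm z) s))
      else ennpow (\<integral>\<^sup>+z. ennreal (cmod (fourier_measure \<mu> z) powr (2 / \<theta>)
                               * norm z powr (s / \<theta> - real DIM('a))) \<partial>lborel) \<theta>)"

text \<open>Inserting 0 implements the convention \<open>sup {} = 0\<close>; the value \<open>\<infinity>\<close> is possible.\<close>

definition fourier_spectrum :: "real \<Rightarrow> 'a::euclidean_space measure \<Rightarrow> ereal" where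
  "fourier_spectrum \<theta> \<mu> = Sup (insert 0 {ereal s | s. s \<ge> 0 \<and> fourier_energy s \<theta> \<mu> < \<infinity>})"

definition fourier_dim :: "'a::euclidean_space measure \<Rightarrow> ereal" where
  "fourier_dim \<mu> = fourier_spectrum 0 \<mu>"

definition sobolev_dim :: "'a::euclidean_space measure \<Rightarrow> ereal" where
  "sobolev_dim \<mu> = fourier_spectrum 1 \<mu>"

end

theory Submission
  imports Defs
begin

text \<open>
  Let \<open>d\<close> be the dimension, \<open>\<mu>\<close> the measure, \<open>F\<close> its Fourier transform and \<open>\<sigma>\<close> the law of
  \<open>y - y'\<close> for independent \<open>\<mu>\<close>-random points \<open>y\<close>, \<open>y'\<close>. The proof rests on the identity
  \<open>|x - y|^2 - |x - y'|^2 = |y|^2 - |y'|^2 - 2 x \<bullet> (y - y')\<close>,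
  whose right-hand side is affine in \<open>x\<close>. For fixed \<open>y\<close>, \<open>y'\<close> its characteristic function under a
  \<open>\<mu>\<close>-random pin \<open>x\<close> is therefore a unimodular constant times a value of \<open>F\<close>. Since the indicator
  of \<open>[-r, r]\<close> is at most \<open>e^(1/2)\<close> times a Gaussian of width \<open>r\<close>, the \<open>\<mu>\<close>-probability that \<open>y\<close> and
  \<open>y'\<close> have squared distances from \<open>x\<close> differing by at most \<open>r\<close> is bounded by a Gaussian average
  over \<open>T\<close> of \<open>|F(T(y-y')/(\<pi>r))|\<close>. Hence everything follows from a decay rate: the integral of
  \<open>|F(\<tau>z)|\<close> with respect to \<open>\<sigma>(dz)\<close> should be at most \<open>C \<tau>^(-t)\<close> for \<open>\<tau> \<ge> 1\<close>.
  For \<open>0 < t < 1\<close> such a rate yields mass \<open>O(r^t)\<close> for the triples \<open>(x, y, y')\<close> above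
  (\<open>distance_small_scale_average\<close>). Summation over dyadic \<open>r\<close> shows that for almost every pin \<open>x\<close>
  the image of \<open>\<mu>\<close> under the distance to \<open>x\<close> has lower local dimension at least \<open>s\<close> almost
  everywhere, for every \<open>s < t\<close> (\<open>AE_distance_local_dimension\<close>), and the mass distribution principle
  (\<open>hausdorff_dim_ge_of_local_dimension\<close>) turns this into a bound for the Hausdorff dimension of
  the pinned distance set.

  The three parts of the theorem are three ways to obtain the decay rate.

  If \<open>|F|^2 \<le> J |z|^(-s)\<close>, then \<open>|F(\<tau>z)| \<le> C (\<tau>|z|)^(-t)\<close> for \<open>t \<le> s/2\<close>, and the \<open>t\<close>-energy of
  \<open>\<mu>\<close> is finite because \<open>\<sigma>\<close> gives small balls little mass (\<open>fourier_average_decay_pointwise\<close>).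

  In the other two cases the integral \<open>K(\<tau>)\<close> of \<open>|F(\<tau>z)|^2\<close> with respect to \<open>\<sigma>\<close> is estimated. As
  \<open>\<mu>\<close> has compact support, \<open>F\<close> is roughly constant at unit scale. The device that makes this
  precise is \<open>\<mu> = e^(-\<pi>|x|^2) \<mu>0\<close>, so that \<open>F\<close> is the convolution of the transform \<open>F0\<close> of \<open>\<mu>0\<close>
  with a Gaussian; the price is that \<open>F0\<close> replaces \<open>F\<close>. But the integral of \<open>|F0|^2\<close> against a Gaussian
  equals the integral of a positive kernel with respect to two copies of \<open>\<mu>0\<close>, and \<open>\<mu>0\<close> is at
  most a constant times \<open>\<mu>\<close>, so \<open>F0\<close> can be replaced by \<open>F\<close> again
  (\<open>fourier_gauss_energy_dominated\<close>). The same holds for fourth powers, because \<open>|F|^2\<close> is itself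
  the transform of \<open>\<sigma>\<close>. With \<open>E(\<tau>)\<close> the integral of \<open>|F|^2\<close>, respectively \<open>|F|^4\<close>, against a Gaussian
  of width of order \<open>\<tau>\<close>, the outcome is \<open>K(\<tau>) \<le> C \<tau>^(-d) E(\<tau>)^2\<close>, respectively
  \<open>K(\<tau>) \<le> C \<tau>^(-d/2) E(\<tau>)\<close>. Finiteness of the energy that defines the Fourier
  spectrum controls \<open>E\<close> (\<open>gauss_energy_le_of_power_energy\<close>) and gives the decay rates
  \<open>min s d - d/2\<close> and \<open>min s (d/2) - d/4\<close>. They saturate at \<open>d/2\<close> and \<open>d/4\<close>, and \<open>d/4\<close> reaches
  the target value 1 as soon as \<open>d \<ge> 4\<close>.
\<close>

section \<open>Gaussians and their Fourier transforms\<close>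

text \<open>Negative parameters are allowed: the weight \<open>gauss (-1)\<close> is the reciprocal of \<open>gauss 1\<close>.\<close>

definition gauss :: "real \<Rightarrow> 'a::euclidean_space \<Rightarrow> real" where
  "gauss a x = exp (- (pi * a * (norm x)\<^sup>2))"

lemma gauss_nonneg [simp]: "0 \<le> gauss a x"
  by (simp add: gauss_def)

lemma gauss_minus [simp]: "gauss a (- x) = gauss a x"
  by (simp add: gauss_def)

lemma gauss_le_1: "0 \<le> a \<Longrightarrow> gauss a x \<le> 1"
  by (simp add: gauss_def)

lemma gauss_scaleR: "gauss a (c *\<^sub>R x) = gauss (a * c\<^sup>2) x"
  by (simp add: gauss_def power_mult_distrib mult_ac)

lemma gauss_antimono: "a \<le> b \<Longrightarrow> gauss b x \<le> gauss a x"
  by (simp add: gauss_def mult_right_mono)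

lemma measurable_gauss [measurable]: "gauss a \<in> borel_measurable borel"
  unfolding gauss_def[abs_def] by measurable

lemma measurable_cis [measurable]: "cis \<in> borel_measurable borel"
  by (intro borel_measurable_continuous_onI continuous_intros)

lemma std_normal_cis_integral:
  "has_bochner_integral lborel (\<lambda>x. std_normal_density x *\<^sub>R cis (t * x)) (complex_of_real (exp (- t\<^sup>2 / 2)))"
proof -
  have int: "integrable lborel (\<lambda>x. std_normal_density x *\<^sub>R cis (t * x))"
    by (rule Bochner_Integration.integrable_bound[OF integrable_normal_density[of 1 0]]) auto
  have "(\<integral>x. std_normal_density x *\<^sub>R cis (t * x) \<partial>lborel) = char std_normal_distribution t"
    unfolding char_def by (subst integral_density) (auto simp: cis_conv_exp)
  then show ?thesis
    using int by (simp add: has_bochner_integral_iff char_std_normal_distribution)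
qed

lemma fourier_gauss_real:
  fixes a x :: real
  assumes a: "a > 0"
  shows "has_bochner_integral lborel (\<lambda>w. exp (- (pi * a * w\<^sup>2)) *\<^sub>R cis (2 * pi * (x * w)))
           (complex_of_real (exp (- (pi * x\<^sup>2 / a)) / sqrt a))"
proof -
  define c where "c = sqrt (2 * pi * a)"
  have c: "c > 0" "c\<^sup>2 = 2 * pi * a" using a by (auto simp: c_def)
  define t where "t = 2 * pi * x / c"
  have "has_bochner_integral lborel (\<lambda>w. std_normal_density (0 + c * w) *\<^sub>R cis (t * (0 + c * w)))
           (complex_of_real (exp (- t\<^sup>2 / 2)) /\<^sub>R \<bar>c\<bar>)"
    using std_normal_cis_integral[of t] c
    by (subst (asm) lborel_has_bochner_integral_real_affine_iff[where c=c and t=0]) auto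
  then have *: "has_bochner_integral lborel (\<lambda>w. sqrt (2 * pi) *\<^sub>R (std_normal_density (0 + c * w) *\<^sub>R cis (t * (0 + c * w))))
           (sqrt (2 * pi) *\<^sub>R (complex_of_real (exp (- t\<^sup>2 / 2)) /\<^sub>R \<bar>c\<bar>))"
    by (intro has_bochner_integral_scaleR_right) auto
  have 1: "sqrt (2 * pi) *\<^sub>R (std_normal_density (0 + c * w) *\<^sub>R cis (t * (0 + c * w))) =
      exp (- (pi * a * w\<^sup>2)) *\<^sub>R cis (2 * pi * (x * w))" for w
    using c by (simp add: std_normal_density_def power_mult_distrib t_def mult_ac)
  have t2: "t\<^sup>2 / 2 = pi * x\<^sup>2 / a"
    using c a by (simp add: t_def power_divide power_mult_distrib field_simps power2_eq_square)
  have 2: "sqrt (2 * pi) *\<^sub>R (complex_of_real (exp (- t\<^sup>2 / 2)) /\<^sub>R \<bar>c\<bar>) = complex_of_real (exp (- (pi * x\<^sup>2 / a)) / sqrt a)"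
    using c a unfolding minus_divide_left[symmetric] t2
    by (simp add: c_def real_sqrt_mult scaleR_conv_of_real field_simps)
  show ?thesis using * unfolding 1 2 .
qed

text \<open>Fubini for products of one-variable functions; it reduces the Fourier transform of a Gaussian to
  dimension one.\<close>

lemma lborel_has_bochner_integral_prod:
  fixes f :: "'a::euclidean_space \<Rightarrow> real \<Rightarrow> complex"
  assumes "\<And>b. b \<in> Basis \<Longrightarrow> has_bochner_integral lborel (f b) (I b)"
  shows "has_bochner_integral lborel (\<lambda>x::'a. \<Prod>b\<in>Basis. f b (x \<bullet> b)) (\<Prod>b\<in>Basis. I b)"
proof -
  interpret product_sigma_finite "\<lambda>_::'a. lborel :: real measure" ..
  have int: "\<And>b. b \<in> Basis \<Longrightarrow> integrable lborel (f b)"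
    and val: "\<And>b. b \<in> Basis \<Longrightarrow> integral\<^sup>L lborel (f b) = I b"
    using assms by (auto simp: has_bochner_integral_iff)
  have [measurable]: "\<And>b. b \<in> Basis \<Longrightarrow> f b \<in> borel_measurable borel"
    using borel_measurable_integrable[OF int] by simp
  have "has_bochner_integral (\<Pi>\<^sub>M b\<in>Basis. lborel) (\<lambda>x. \<Prod>b\<in>(Basis::'a set). f b (x b)) (\<Prod>b\<in>Basis. I b)"
    using product_integrable_prod[of Basis f] product_integral_prod[of Basis f] int val
    by (auto simp: has_bochner_integral_iff)
  moreover have "(\<Prod>b\<in>(Basis::'a set). f b (x b)) = (\<Prod>b\<in>Basis. f b ((\<Sum>b\<in>Basis. x b *\<^sub>R b) \<bullet> b))" for x
    by (intro prod.cong refl) simp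
  ultimately have "has_bochner_integral (\<Pi>\<^sub>M b\<in>Basis. lborel) (\<lambda>x. \<Prod>b\<in>(Basis::'a set). f b ((\<Sum>b\<in>Basis. x b *\<^sub>R b) \<bullet> b)) (\<Prod>b\<in>Basis. I b)"
    by simp
  then show ?thesis
    by (subst lborel_eq, intro has_bochner_integral_distr) simp_all
qed

lemma cis_sum: "finite A \<Longrightarrow> cis (\<Sum>i\<in>A. f i) = (\<Prod>i\<in>A. cis (f i))"
  by (induction A rule: finite_induct) (auto simp: cis_mult[symmetric])

lemma fourier_gauss:
  fixes x :: "'a::euclidean_space"
  assumes a: "a > 0"
  shows "has_bochner_integral lborel (\<lambda>w. gauss a w *\<^sub>R cis (2 * pi * (x \<bullet> w)))
           (complex_of_real ((1 / sqrt a) ^ DIM('a) * gauss (1 / a) x))"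
proof -
  have n2: "(norm y)\<^sup>2 = (\<Sum>b\<in>Basis. (y \<bullet> b)\<^sup>2)" for y :: 'a
    by (subst power2_norm_eq_inner, subst euclidean_inner) (simp add: power2_eq_square)
  have 1: "gauss a w *\<^sub>R cis (2 * pi * (x \<bullet> w)) =
      (\<Prod>b\<in>Basis. exp (- (pi * a * (w \<bullet> b)\<^sup>2)) *\<^sub>R cis (2 * pi * ((x \<bullet> b) * (w \<bullet> b))))" for w
  proof -
    have "gauss a w = (\<Prod>b\<in>Basis. exp (- (pi * a * (w \<bullet> b)\<^sup>2)))"
      unfolding gauss_def n2 sum_distrib_left sum_negf[symmetric] by (rule exp_sum) simp
    moreover have "cis (2 * pi * (x \<bullet> w)) = (\<Prod>b\<in>Basis. cis (2 * pi * ((x \<bullet> b) * (w \<bullet> b))))"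
      unfolding euclidean_inner[of x w] sum_distrib_left by (rule cis_sum) simp
    ultimately show ?thesis
      by (simp add: scaleR_conv_of_real prod.distrib)
  qed
  have 2: "complex_of_real ((1 / sqrt a) ^ DIM('a) * gauss (1 / a) x) =
     (\<Prod>b\<in>Basis. complex_of_real (exp (- (pi * (x \<bullet> b)\<^sup>2 / a)) / sqrt a))"
  proof -
    have "gauss (1 / a) x = (\<Prod>b\<in>Basis. exp (- (pi * (x \<bullet> b)\<^sup>2 / a)))"
      unfolding gauss_def n2 sum_distrib_left sum_negf[symmetric] by (subst exp_sum) simp_all
    then show ?thesis
      by (simp add: prod_dividef power_divide)
  qed
  show ?thesis
    unfolding 1 2 using a by (intro lborel_has_bochner_integral_prod fourier_gauss_real)
qed

lemma has_bochner_integral_gauss: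
  assumes a: "a > 0"
  shows "has_bochner_integral lborel (gauss a :: 'a::euclidean_space \<Rightarrow> real) ((1 / sqrt a) ^ DIM('a))"
proof -
  have "has_bochner_integral lborel (\<lambda>w::'a. complex_of_real (gauss a w)) (complex_of_real ((1 / sqrt a) ^ DIM('a)))"
    using fourier_gauss[OF a, of 0] by (simp add: scaleR_conv_of_real gauss_def)
  from has_bochner_integral_Re[OF this] show ?thesis by simp
qed

lemma nn_integral_gauss:
  "a > 0 \<Longrightarrow> (\<integral>\<^sup>+w. ennreal (gauss a (w::'a::euclidean_space)) \<partial>lborel) = ennreal ((1 / sqrt a) ^ DIM('a))"
  by (subst nn_integral_eq_integral) (use has_bochner_integral_gauss in \<open>auto simp: has_bochner_integral_iff\<close>)

section \<open>Fourier transforms of finite measures\<close>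

lemma measurable_fourier_measure:
  fixes M :: "'a::euclidean_space measure"
  assumes "finite_measure M" and sets [measurable_cong]: "sets M = sets borel"
  shows "fourier_measure M \<in> borel_measurable borel"
proof -
  interpret finite_measure M by fact
  show ?thesis unfolding fourier_measure_def[abs_def] by measurable
qed

lemma integrable_cis:
  assumes "finite_measure M" "f \<in> borel_measurable M"
  shows "integrable M (\<lambda>x. cis (f x))"
proof -
  interpret finite_measure M by fact
  have [measurable]: "f \<in> borel_measurable M" by fact
  show ?thesis by (rule integrable_const_bound[of _ 1]) auto
qed

lemma norm_fourier_measure_le:
  fixes M :: "'a::euclidean_space measure"
  assumes "finite_measure M" and sets [measurable_cong]: "sets M = sets borel"
  shows "cmod (fourier_measure M z) \<le> measure M (space M)"
proof -
  interpret finite_measure M by fact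
  have "cmod (fourier_measure M z) \<le> (\<integral>x. cmod (cis (- (2 * pi * (z \<bullet> x)))) \<partial>M)"
    unfolding fourier_measure_def by (rule integral_norm_bound)
  then show ?thesis by simp
qed

lemma norm_fourier_measure_le_1:
  fixes M :: "'a::euclidean_space measure"
  assumes "prob_space M" and "sets M = sets borel"
  shows "cmod (fourier_measure M z) \<le> 1"
  using norm_fourier_measure_le[of M z] assms
  by (simp add: prob_space.prob_space prob_space.finite_measure)

lemma fourier_measure_minus:
  fixes M :: "'a::euclidean_space measure"
  shows "fourier_measure M (- z) = cnj (fourier_measure M z)"
  unfolding fourier_measure_def by (subst Bochner_Integration.integral_cnj[symmetric]) (simp add: cis_cnj)

text \<open>Interchanging the two integrals leaves the Fourier transform of a Gaussian inside. This is the
  only form of Fourier inversion that the proof needs.\<close>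

lemma parseval_gauss:
  fixes N :: "'a::euclidean_space measure"
  assumes "finite_measure N" and sets [measurable_cong]: "sets N = sets borel" and a: "a > 0"
  shows "(\<integral>v. (gauss a v *\<^sub>R cis (2 * pi * (p \<bullet> v))) * fourier_measure N v \<partial>lborel)
          = complex_of_real ((1 / sqrt a) ^ DIM('a) * (\<integral>z. gauss (1 / a) (p - z) \<partial>N))"
proof -
  interpret finite_measure N by fact
  interpret P: pair_sigma_finite "lborel :: 'a measure" N ..
  let ?f = "\<lambda>v z. gauss a v *\<^sub>R cis (2 * pi * ((p - z) \<bullet> v))"
  have ga: "integrable lborel (gauss a :: 'a \<Rightarrow> real)"
    by (rule integrable.intros[OF has_bochner_integral_gauss[OF a]])
  have int: "integrable (lborel \<Otimes>\<^sub>M N) (\<lambda>(v, z). ?f v z)"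
  proof (rule P.Fubini_integrable)
    show "(\<lambda>(v, z). ?f v z) \<in> borel_measurable (lborel \<Otimes>\<^sub>M N)" by measurable
    show "integrable lborel (\<lambda>x. \<integral>y. norm (case (x, y) of (v, z) \<Rightarrow> ?f v z) \<partial>N)"
      using ga by simp
    show "AE x in lborel. integrable N (\<lambda>y. case (x, y) of (v, z) \<Rightarrow> ?f v z)"
      by (intro AE_I2) (auto intro!: integrable_scaleR_right integrable_cis finite_measure_axioms)
  qed
  have "(\<integral>v. (gauss a v *\<^sub>R cis (2 * pi * (p \<bullet> v))) * fourier_measure N v \<partial>lborel)
      = (\<integral>v. \<integral>z. ?f v z \<partial>N \<partial>lborel)"
  proof (intro Bochner_Integration.integral_cong refl)
    fix v :: 'a
    have "(\<integral>z. ?f v z \<partial>N) = (\<integral>z. (gauss a v *\<^sub>R cis (2 * pi * (p \<bullet> v))) * cis (- (2 * pi * (v \<bullet> z))) \<partial>N)"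
      by (intro Bochner_Integration.integral_cong refl)
        (simp add: cis_mult inner_diff_left algebra_simps inner_commute)
    also have "\<dots> = (gauss a v *\<^sub>R cis (2 * pi * (p \<bullet> v))) * fourier_measure N v"
      unfolding fourier_measure_def by (rule integral_mult_right_zero)
    finally show "(gauss a v *\<^sub>R cis (2 * pi * (p \<bullet> v))) * fourier_measure N v = (\<integral>z. ?f v z \<partial>N)" ..
  qed
  also have "\<dots> = (\<integral>z. \<integral>v. ?f v z \<partial>lborel \<partial>N)"
    using P.Fubini_integral[OF int] by simp
  also have "\<dots> = (\<integral>z. complex_of_real ((1 / sqrt a) ^ DIM('a) * gauss (1 / a) (p - z)) \<partial>N)"
    by (intro Bochner_Integration.integral_cong refl has_bochner_integral_integral_eq fourier_gauss a)
  also have "\<dots> = complex_of_real ((1 / sqrt a) ^ DIM('a) * (\<integral>z. gauss (1 / a) (p - z) \<partial>N))"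
    by (simp only: integral_complex_of_real integral_mult_right_zero)
  finally show ?thesis .
qed

lemma nn_integral_eq_integral_gauss:
  assumes "finite_measure N" and sets [measurable_cong]: "sets N = sets borel" and b: "b \<ge> 0"
  shows "(\<integral>\<^sup>+z. ennreal (gauss b (p - z)) \<partial>N) = ennreal (\<integral>z. gauss b (p - z) \<partial>N)"
proof -
  interpret finite_measure N by fact
  show ?thesis
    by (rule nn_integral_eq_integral, rule integrable_const_bound[of _ 1]) (auto simp: gauss_le_1 b)
qed

lemma norm_integral_le_nn_integral:
  fixes f :: "'a \<Rightarrow> 'b::{banach, second_countable_topology}"
  shows "ennreal (norm (\<integral>x. f x \<partial>M)) \<le> (\<integral>\<^sup>+x. ennreal (norm (f x)) \<partial>M)"
proof (cases "integrable M f")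
  case True
  then show ?thesis by (rule integral_norm_bound_ennreal)
qed (simp add: not_integrable_integral_eq)

text \<open>Taking absolute values inside the Parseval identity removes the dependence on the centre \<open>p\<close>:
  the mass that \<open>N\<close> gives to a ball is controlled by its transform uniformly in the position of the ball.\<close>

lemma gauss_mass_le_fourier:
  fixes N :: "'a::euclidean_space measure"
  assumes N: "finite_measure N" and sets [measurable_cong]: "sets N = sets borel" and a: "a > 0"
  shows "ennreal ((1 / sqrt a) ^ DIM('a)) * (\<integral>\<^sup>+z. ennreal (gauss (1 / a) (p - z)) \<partial>N)
    \<le> (\<integral>\<^sup>+v. ennreal (cmod (fourier_measure N v) * gauss a v) \<partial>lborel)"
proof -
  let ?g = "\<lambda>v. (gauss a v *\<^sub>R cis (2 * pi * (p \<bullet> v))) * fourier_measure N v"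
  let ?m = "\<integral>z. gauss (1 / a) (p - z) \<partial>N"
  have m: "?m \<ge> 0" by simp
  have "ennreal ((1 / sqrt a) ^ DIM('a)) * (\<integral>\<^sup>+z. ennreal (gauss (1 / a) (p - z)) \<partial>N)
     = ennreal ((1 / sqrt a) ^ DIM('a) * ?m)"
    using m a by (subst nn_integral_eq_integral_gauss[OF N sets]) (auto simp: ennreal_mult)
  also have "(1 / sqrt a) ^ DIM('a) * ?m = norm (\<integral>v. ?g v \<partial>lborel)"
    unfolding parseval_gauss[OF N sets a] using m a by (simp add: norm_mult norm_power norm_divide)
  also have "ennreal \<dots> \<le> (\<integral>\<^sup>+v. norm (?g v) \<partial>lborel)"
    by (rule norm_integral_le_nn_integral)
  also have "(\<integral>\<^sup>+v. norm (?g v) \<partial>lborel) = (\<integral>\<^sup>+v. ennreal (cmod (fourier_measure N v) * gauss a v) \<partial>lborel)"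
    by (simp add: norm_mult mult.commute)
  finally show ?thesis .
qed

section \<open>The law of a difference and positivity\<close>

text \<open>The law of \<open>x - y\<close> for independent \<open>x\<close>, \<open>y\<close>. Its Fourier transform is \<open>|F|^2\<close>, so that facts
  about squares of Fourier transforms also apply to fourth powers.\<close>

definition difference_measure :: "'a::euclidean_space measure \<Rightarrow> 'a measure" where
  "difference_measure M = distr (M \<Otimes>\<^sub>M M) borel (\<lambda>(x, y). x - y)"

lemma sets_difference_measure [simp, measurable_cong]: "sets (difference_measure M) = sets borel"
  by (simp add: difference_measure_def)

lemma space_difference_measure [simp]: "space (difference_measure M) = UNIV"
  by (simp add: difference_measure_def)

lemma nn_integral_difference_measure:
  fixes M :: "'a::euclidean_space measure"
  assumes "finite_measure M" and sets [measurable_cong]: "sets M = sets borel"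
    and [measurable]: "f \<in> borel_measurable borel"
  shows "(\<integral>\<^sup>+z. f z \<partial>difference_measure M) = (\<integral>\<^sup>+x. \<integral>\<^sup>+y. f (x - y) \<partial>M \<partial>M)"
proof -
  interpret finite_measure M by fact
  have "(\<integral>\<^sup>+z. f z \<partial>difference_measure M) = (\<integral>\<^sup>+p. f (fst p - snd p) \<partial>(M \<Otimes>\<^sub>M M))"
    unfolding difference_measure_def by (subst nn_integral_distr) (auto simp: split_beta')
  also have "\<dots> = (\<integral>\<^sup>+x. \<integral>\<^sup>+y. f (x - y) \<partial>M \<partial>M)"
    by (subst nn_integral_fst[symmetric]) auto
  finally show ?thesis .
qed

lemma finite_measure_difference_measure:
  fixes M :: "'a::euclidean_space measure"
  assumes "finite_measure M" and sets [measurable_cong]: "sets M = sets borel"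
  shows "finite_measure (difference_measure M)"
proof -
  interpret finite_measure M by fact
  interpret P: pair_sigma_finite M M ..
  have "finite_measure (M \<Otimes>\<^sub>M M)" by (rule finite_measure_pair_measure) fact+
  then show ?thesis
    unfolding difference_measure_def by (rule finite_measure.finite_measure_distr) measurable
qed

lemma prob_space_difference_measure:
  fixes M :: "'a::euclidean_space measure"
  assumes "prob_space M" and sets [measurable_cong]: "sets M = sets borel"
  shows "prob_space (difference_measure M)"
proof -
  interpret prob_space M by fact
  interpret pair_prob_space M M ..
  show ?thesis
    unfolding difference_measure_def by (rule prob_space_distr) measurable
qed

lemma fourier_difference_measure:
  fixes M :: "'a::euclidean_space measure"
  assumes M: "finite_measure M" and sets [measurable_cong]: "sets M = sets borel"
  shows "fourier_measure (difference_measure M) v = complex_of_real ((cmod (fourier_measure M v))\<^sup>2)"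
proof -
  interpret finite_measure M by fact
  interpret P: pair_sigma_finite M M ..
  have fin2: "finite_measure (M \<Otimes>\<^sub>M M)" by (rule finite_measure_pair_measure) fact+
  let ?f = "\<lambda>p. cis (- (2 * pi * (v \<bullet> (fst p - snd p))))"
  have "fourier_measure (difference_measure M) v = (\<integral>p. ?f p \<partial>(M \<Otimes>\<^sub>M M))"
    unfolding fourier_measure_def difference_measure_def by (subst integral_distr) (auto simp: split_beta')
  also have "\<dots> = (\<integral>x. \<integral>y. cis (- (2 * pi * (v \<bullet> (x - y)))) \<partial>M \<partial>M)"
    by (subst P.integral_fst'[symmetric]) (auto intro!: integrable_cis fin2)
  also have "\<dots> = (\<integral>x. cis (- (2 * pi * (v \<bullet> x))) * cnj (fourier_measure M v) \<partial>M)"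
    unfolding fourier_measure_def
    by (subst Bochner_Integration.integral_cnj[symmetric], subst integral_mult_right_zero[symmetric])
      (auto intro!: Bochner_Integration.integral_cong simp: cis_cnj cis_mult algebra_simps)
  also have "\<dots> = fourier_measure M v * cnj (fourier_measure M v)"
    unfolding fourier_measure_def by simp
  also have "\<dots> = complex_of_real ((cmod (fourier_measure M v))\<^sup>2)"
    by (rule complex_norm_square[symmetric])
  finally show ?thesis .
qed

text \<open>The right-hand side is the integral of a positive kernel against two copies of \<open>M\<close>. It is
  monotone in \<open>M\<close>, which is not at all visible on the left.\<close>

lemma fourier_gauss_energy:
  fixes M :: "'a::euclidean_space measure"
  assumes M: "finite_measure M" and sets [measurable_cong]: "sets M = sets borel" and a: "a > 0"
  shows "(\<integral>\<^sup>+v. ennreal ((cmod (fourier_measure M v))\<^sup>2 * gauss a v) \<partial>lborel)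
    = ennreal ((1 / sqrt a) ^ DIM('a)) * (\<integral>\<^sup>+z. ennreal (gauss (1 / a) z) \<partial>difference_measure M)"
proof -
  let ?N = "difference_measure M"
  have N: "finite_measure ?N" by (rule finite_measure_difference_measure[OF M sets])
  note [measurable] = measurable_fourier_measure[OF M sets]
  have ga: "integrable lborel (gauss a :: 'a \<Rightarrow> real)"
    by (rule integrable.intros[OF has_bochner_integral_gauss[OF a]])
  have int: "integrable lborel (\<lambda>v. (cmod (fourier_measure M v))\<^sup>2 * gauss a v)"
  proof (rule Bochner_Integration.integrable_bound)
    show "integrable lborel (\<lambda>v::'a. (measure M (space M))\<^sup>2 * gauss a v)" using ga by simp
    show "AE v in lborel. norm ((cmod (fourier_measure M v))\<^sup>2 * gauss a v)
            \<le> norm ((measure M (space M))\<^sup>2 * gauss a v)"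
      by (auto intro!: AE_I2 mult_right_mono power_mono norm_fourier_measure_le[OF M sets] simp: abs_mult)
  qed simp
  have "complex_of_real (\<integral>v. (cmod (fourier_measure M v))\<^sup>2 * gauss a v \<partial>lborel)
     = (\<integral>v. (gauss a v *\<^sub>R cis (2 * pi * (0 \<bullet> v))) * fourier_measure ?N v \<partial>lborel)"
    unfolding fourier_difference_measure[OF M sets] integral_complex_of_real[symmetric]
    by (intro Bochner_Integration.integral_cong refl) (simp add: scaleR_conv_of_real mult.commute)
  also have "\<dots> = complex_of_real ((1 / sqrt a) ^ DIM('a) * (\<integral>z. gauss (1 / a) z \<partial>?N))"
    by (subst parseval_gauss[OF N _ a]) auto
  finally have eq: "(\<integral>v. (cmod (fourier_measure M v))\<^sup>2 * gauss a v \<partial>lborel)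
     = (1 / sqrt a) ^ DIM('a) * (\<integral>z. gauss (1 / a) z \<partial>?N)"
    unfolding of_real_eq_iff .
  have "(\<integral>\<^sup>+v. ennreal ((cmod (fourier_measure M v))\<^sup>2 * gauss a v) \<partial>lborel)
    = ennreal (\<integral>v. (cmod (fourier_measure M v))\<^sup>2 * gauss a v \<partial>lborel)"
    by (rule nn_integral_eq_integral[OF int]) auto
  also have "\<dots> = ennreal ((1 / sqrt a) ^ DIM('a)) * ennreal (\<integral>z. gauss (1 / a) z \<partial>?N)"
    unfolding eq using a by (intro ennreal_mult) auto
  also have "ennreal (\<integral>z. gauss (1 / a) z \<partial>?N) = (\<integral>\<^sup>+z. ennreal (gauss (1 / a) z) \<partial>?N)"
    using nn_integral_eq_integral_gauss[OF N _, of "1 / a" 0] a by simp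
  finally show ?thesis .
qed

text \<open>Domination is stated through integrals because it then passes to difference measures by
  integrating one variable at a time.\<close>

definition dominated :: "'a::euclidean_space measure \<Rightarrow> ennreal \<Rightarrow> 'a measure \<Rightarrow> bool" where
  "dominated N0 C N \<longleftrightarrow> (\<forall>f\<in>borel_measurable borel. (\<integral>\<^sup>+x. f x \<partial>N0) \<le> C * (\<integral>\<^sup>+x. f x \<partial>N))"

lemma dominated_difference_measure:
  fixes M :: "'a::euclidean_space measure"
  assumes M0: "finite_measure M0" and sets0 [measurable_cong]: "sets M0 = sets borel"
    and M: "finite_measure M" and sets [measurable_cong]: "sets M = sets borel"
    and dom: "dominated M0 C M"
  shows "dominated (difference_measure M0) (C * C) (difference_measure M)"
  unfolding dominated_def
proof
  fix f :: "'a \<Rightarrow> ennreal" assume f [measurable]: "f \<in> borel_measurable borel"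
  interpret M: finite_measure M by fact
  interpret M0: finite_measure M0 by fact
  have le: "(\<integral>\<^sup>+x. g x \<partial>M0) \<le> C * (\<integral>\<^sup>+x. g x \<partial>M)" if "g \<in> borel_measurable borel" for g
    using dom that by (auto simp: dominated_def)
  have "(\<integral>\<^sup>+z. f z \<partial>difference_measure M0) = (\<integral>\<^sup>+x. \<integral>\<^sup>+y. f (x - y) \<partial>M0 \<partial>M0)"
    by (rule nn_integral_difference_measure[OF M0 sets0 f])
  also have "\<dots> \<le> (\<integral>\<^sup>+x. C * (\<integral>\<^sup>+y. f (x - y) \<partial>M) \<partial>M0)"
    by (intro nn_integral_mono le) measurable
  also have "\<dots> \<le> C * (\<integral>\<^sup>+x. C * (\<integral>\<^sup>+y. f (x - y) \<partial>M) \<partial>M)"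
    by (intro le) measurable
  also have "\<dots> = C * C * (\<integral>\<^sup>+z. f z \<partial>difference_measure M)"
    unfolding nn_integral_difference_measure[OF M sets f]
    by (subst nn_integral_cmult) (auto simp: mult.assoc)
  finally show "(\<integral>\<^sup>+z. f z \<partial>difference_measure M0) \<le> C * C * (\<integral>\<^sup>+z. f z \<partial>difference_measure M)" .
qed

text \<open>Absolute values of Fourier transforms do not respect inequalities between measures, but their
  Gaussian square means do.\<close>

lemma fourier_gauss_energy_dominated:
  fixes M :: "'a::euclidean_space measure"
  assumes M0: "finite_measure M0" and sets0: "sets M0 = sets borel"
    and M: "finite_measure M" and sets: "sets M = sets borel"
    and dom: "dominated M0 C M" and a: "a > 0"
  shows "(\<integral>\<^sup>+v. ennreal ((cmod (fourier_measure M0 v))\<^sup>2 * gauss a v) \<partial>lborel)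
    \<le> C * C * (\<integral>\<^sup>+v. ennreal ((cmod (fourier_measure M v))\<^sup>2 * gauss a v) \<partial>lborel)"
proof -
  have "(\<integral>\<^sup>+z. ennreal (gauss (1 / a) z) \<partial>difference_measure M0) \<le>
      C * C * (\<integral>\<^sup>+z. ennreal (gauss (1 / a) z) \<partial>difference_measure M)"
    using dominated_difference_measure[OF M0 sets0 M sets dom] by (auto simp: dominated_def)
  from mult_left_mono[OF this, of "ennreal ((1 / sqrt a) ^ DIM('a))"] show ?thesis
    unfolding fourier_gauss_energy[OF M0 sets0 a] fourier_gauss_energy[OF M sets a]
    by (simp add: mult_ac)
qed

section \<open>Smoothing the transform of a compactly supported measure\<close>

lemma nn_integral_lborel_reflect:
  fixes f :: "'a::euclidean_space \<Rightarrow> ennreal"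
  assumes [measurable]: "f \<in> borel_measurable borel"
  shows "(\<integral>\<^sup>+x. f (t - x) \<partial>lborel) = (\<integral>\<^sup>+x. f x \<partial>lborel)"
proof -
  have eq: "lborel = distr lborel borel (\<lambda>x. t - x)"
    using lborel_affine[of "-1" t] by (simp add: density_1)
  have "(\<integral>\<^sup>+x. f x \<partial>distr lborel borel (\<lambda>x. t - x)) = (\<integral>\<^sup>+x. f (t - x) \<partial>lborel)"
    by (rule nn_integral_distr) measurable
  then show ?thesis by (simp only: eq[symmetric])
qed

lemma (in prob_space) integral_square_le:
  fixes g :: "'a \<Rightarrow> real"
  assumes [measurable]: "g \<in> borel_measurable M" and b: "\<And>x. \<bar>g x\<bar> \<le> B"
  shows "(\<integral>x. g x \<partial>M)\<^sup>2 \<le> (\<integral>x. (g x)\<^sup>2 \<partial>M)"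
proof -
  have b2: "(g x)\<^sup>2 \<le> B\<^sup>2" for x using power_mono[OF b, of x 2] by simp
  have "integrable M g"
    by (rule integrable_const_bound[of _ B]) (use b in auto)
  moreover have "integrable M (\<lambda>x. (g x)\<^sup>2)"
    by (rule integrable_const_bound[of _ "B\<^sup>2"]) (use b2 in simp_all)
  ultimately show ?thesis
    using variance_positive[of g] variance_eq[of g] by simp
qed

text \<open>Multiplying a measure by \<open>gauss 1\<close> convolves its transform with \<open>gauss 1\<close>. A measure with
  bounded support can be divided by \<open>gauss 1\<close> first, so its transform is such a convolution.\<close>

lemma fourier_measure_eq_gauss_average:
  fixes M :: "'a::euclidean_space measure"
  assumes M: "prob_space M" and sets [measurable_cong]: "sets M = sets borel"
    and R: "AE x in M. norm x \<le> R"
  defines "M0 \<equiv> density M (\<lambda>x. ennreal (gauss (-1) x))"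
  shows "fourier_measure M u = (\<integral>w. gauss 1 w *\<^sub>R fourier_measure M0 (u - w) \<partial>lborel)"
proof -
  interpret prob_space M by fact
  interpret P: pair_sigma_finite "lborel :: 'a measure" M ..
  let ?f = "\<lambda>w x. (gauss 1 w *\<^sub>R (gauss (-1) x *\<^sub>R cis (- (2 * pi * ((u - w) \<bullet> x)))))"
  have ga: "integrable lborel (gauss 1 :: 'a \<Rightarrow> real)"
    by (rule integrable.intros[OF has_bochner_integral_gauss]) simp
  have bound: "AE x in M. gauss (-1) x \<le> exp (pi * R\<^sup>2)"
    using R by eventually_elim (auto simp: gauss_def intro!: power_mono)
  have int0: "integrable M (\<lambda>x. gauss (-1) x)"
    by (rule integrable_const_bound[of _ "exp (pi * R\<^sup>2)"]) (use bound in auto)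
  have int: "integrable (lborel \<Otimes>\<^sub>M M) (\<lambda>(w, x). ?f w x)"
  proof (rule P.Fubini_integrable)
    show "(\<lambda>(w, x). ?f w x) \<in> borel_measurable (lborel \<Otimes>\<^sub>M M)" by measurable
    show "integrable lborel (\<lambda>x. \<integral>y. norm (case (x, y) of (w, x) \<Rightarrow> ?f w x) \<partial>M)"
      using ga by simp
    show "AE x in lborel. integrable M (\<lambda>y. case (x, y) of (w, x) \<Rightarrow> ?f w x)"
    proof (rule AE_I2)
      fix w :: 'a
      have "integrable M (\<lambda>x. gauss (-1) x *\<^sub>R cis (- (2 * pi * ((u - w) \<bullet> x))))"
        by (rule Bochner_Integration.integrable_bound[OF int0]) auto
      then have "integrable M (?f w)"
        by (rule integrable_scaleR_right)
      then show "integrable M (\<lambda>y. case (w, y) of (w, x) \<Rightarrow> ?f w x)"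
        by (simp only: prod.case)
    qed
  qed
  have "(\<integral>w. gauss 1 w *\<^sub>R fourier_measure M0 (u - w) \<partial>lborel) = (\<integral>w. \<integral>x. ?f w x \<partial>M \<partial>lborel)"
    unfolding fourier_measure_def M0_def
    by (subst integral_density) (auto simp del: scaleR_scaleR)
  also have "\<dots> = (\<integral>x. \<integral>w. ?f w x \<partial>lborel \<partial>M)"
    using P.Fubini_integral[OF int] by simp
  also have "\<dots> = (\<integral>x. cis (- (2 * pi * (u \<bullet> x))) \<partial>M)"
  proof (intro Bochner_Integration.integral_cong refl)
    fix x
    have "(\<integral>w. ?f w x \<partial>lborel) = (\<integral>w. (gauss (-1) x *\<^sub>R cis (- (2 * pi * (u \<bullet> x)))) * (gauss 1 w *\<^sub>R cis (2 * pi * (x \<bullet> w))) \<partial>lborel)"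
      by (intro Bochner_Integration.integral_cong refl)
        (simp add: cis_mult inner_diff_left algebra_simps inner_commute)
    also have "\<dots> = (gauss (-1) x *\<^sub>R cis (- (2 * pi * (u \<bullet> x)))) * complex_of_real (gauss 1 x)"
      unfolding integral_mult_right_zero
      using has_bochner_integral_integral_eq[OF fourier_gauss[of 1 x]] by simp
    also have "\<dots> = (gauss (-1) x * gauss 1 x) *\<^sub>R cis (- (2 * pi * (u \<bullet> x)))"
      by (simp add: scaleR_conv_of_real)
    also have "gauss (-1) x * gauss 1 x = 1"
      by (simp add: gauss_def exp_add[symmetric])
    finally show "(\<integral>w. ?f w x \<partial>lborel) = cis (- (2 * pi * (u \<bullet> x)))" by simp
  qed
  finally show ?thesis by (simp add: fourier_measure_def)
qed

text \<open>On a bounded support the weight \<open>gauss (-1)\<close> is bounded.\<close>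

lemma
  fixes M :: "'a::euclidean_space measure"
  assumes M: "prob_space M" and sets [measurable_cong]: "sets M = sets borel"
    and R: "AE x in M. norm x \<le> R"
  defines "M0 \<equiv> density M (\<lambda>x. ennreal (gauss (-1) x))"
  shows dominated_density_gauss: "dominated M0 (ennreal (exp (pi * R\<^sup>2))) M"
    and finite_density_gauss: "finite_measure M0"
    and sets_density_gauss: "sets M0 = sets borel"
proof -
  interpret prob_space M by fact
  have bound: "AE x in M. gauss (-1) x \<le> exp (pi * R\<^sup>2)"
    using R by eventually_elim (auto simp: gauss_def intro!: power_mono)
  show dom: "dominated M0 (ennreal (exp (pi * R\<^sup>2))) M"
    unfolding dominated_def M0_def
  proof
    fix f :: "'a \<Rightarrow> ennreal" assume [measurable]: "f \<in> borel_measurable borel"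
    have "(\<integral>\<^sup>+x. f x \<partial>density M (\<lambda>x. ennreal (gauss (-1) x))) = (\<integral>\<^sup>+x. ennreal (gauss (-1) x) * f x \<partial>M)"
      by (rule nn_integral_density) measurable
    also have "\<dots> \<le> (\<integral>\<^sup>+x. ennreal (exp (pi * R\<^sup>2)) * f x \<partial>M)"
      by (rule nn_integral_mono_AE) (use bound in \<open>auto intro!: mult_right_mono ennreal_leI\<close>)
    also have "\<dots> = ennreal (exp (pi * R\<^sup>2)) * (\<integral>\<^sup>+x. f x \<partial>M)"
      by (rule nn_integral_cmult) measurable
    finally show "(\<integral>\<^sup>+x. f x \<partial>density M (\<lambda>x. ennreal (gauss (-1) x))) \<le> ennreal (exp (pi * R\<^sup>2)) * (\<integral>\<^sup>+x. f x \<partial>M)" .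
  qed
  have "emeasure M0 (space M0) = (\<integral>\<^sup>+x. 1 \<partial>M0)" by simp
  also have "\<dots> \<le> ennreal (exp (pi * R\<^sup>2)) * (\<integral>\<^sup>+x. 1 \<partial>M)"
    by (rule dom[unfolded dominated_def, rule_format]) simp
  also have "\<dots> < \<infinity>" by (simp add: emeasure_space_1)
  finally show "finite_measure M0" by (intro finite_measureI) auto
  show "sets M0 = sets borel" by (simp add: M0_def sets)
qed

text \<open>Jensen's inequality for the Gaussian probability measure in the convolution formula.\<close>

lemma fourier_measure_square_le_gauss_average:
  fixes M :: "'a::euclidean_space measure"
  assumes M: "prob_space M" and sets [measurable_cong]: "sets M = sets borel"
    and R: "AE x in M. norm x \<le> R"
  defines "M0 \<equiv> density M (\<lambda>x. ennreal (gauss (-1) x))"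
  shows "ennreal ((cmod (fourier_measure M u))\<^sup>2)
    \<le> (\<integral>\<^sup>+v. ennreal ((cmod (fourier_measure M0 v))\<^sup>2 * gauss 1 (u - v)) \<partial>lborel)"
proof -
  note M0 = finite_density_gauss[OF M sets R, folded M0_def]
    and sets0 = sets_density_gauss[OF M sets R, folded M0_def]
  note [measurable] = measurable_fourier_measure[OF M0 sets0]
  let ?F = "\<lambda>w. cmod (fourier_measure M0 (u - w))"
  define G :: "'a measure" where "G = density lborel (\<lambda>w. ennreal (gauss 1 w))"
  have [measurable_cong]: "sets G = sets borel" by (simp add: G_def)
  interpret G: prob_space G
    by (rule prob_spaceI) (simp add: G_def emeasure_density nn_integral_gauss)
  have "cmod (fourier_measure M u) \<le> (\<integral>w. norm (gauss 1 w *\<^sub>R fourier_measure M0 (u - w)) \<partial>lborel)"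
    unfolding fourier_measure_eq_gauss_average[OF M sets R, folded M0_def]
    by (rule integral_norm_bound)
  also have "\<dots> = (\<integral>w. ?F w \<partial>G)"
    unfolding G_def by (subst integral_density) auto
  finally have "(cmod (fourier_measure M u))\<^sup>2 \<le> (\<integral>w. ?F w \<partial>G)\<^sup>2"
    by (intro power_mono) auto
  also have "\<dots> \<le> (\<integral>w. (?F w)\<^sup>2 \<partial>G)"
    by (rule G.integral_square_le[of _ "measure M0 (space M0)"])
      (auto intro!: norm_fourier_measure_le[OF M0 sets0])
  finally have "ennreal ((cmod (fourier_measure M u))\<^sup>2) \<le> ennreal (\<integral>w. (?F w)\<^sup>2 \<partial>G)"
    by (rule ennreal_leI)
  also have "ennreal (\<integral>w. (?F w)\<^sup>2 \<partial>G) = (\<integral>\<^sup>+w. ennreal ((?F w)\<^sup>2) \<partial>G)"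
    by (rule nn_integral_eq_integral[symmetric], rule G.integrable_const_bound[of _ "(measure M0 (space M0))\<^sup>2"])
      (auto intro!: power_mono norm_fourier_measure_le[OF M0 sets0])
  also have "\<dots> = (\<integral>\<^sup>+w. ennreal ((?F w)\<^sup>2 * gauss 1 (u - (u - w))) \<partial>lborel)"
    unfolding G_def by (subst nn_integral_density) (auto simp: ennreal_mult mult.commute)
  also have "\<dots> = (\<integral>\<^sup>+v. ennreal ((cmod (fourier_measure M0 v))\<^sup>2 * gauss 1 (u - v)) \<partial>lborel)"
    by (rule nn_integral_lborel_reflect[of "\<lambda>v. ennreal ((cmod (fourier_measure M0 v))\<^sup>2 * gauss 1 (u - v))"]) measurable
  finally show ?thesis .
qed

lemma AE_difference_measure_bounded:
  fixes M :: "'a::euclidean_space measure"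
  assumes M: "prob_space M" and sets [measurable_cong]: "sets M = sets borel"
    and R: "AE x in M. norm x \<le> R"
  shows "AE z in difference_measure M. norm z \<le> 2 * R"
proof -
  interpret prob_space M by fact
  note fin = finite_measure_axioms
  have "(\<integral>\<^sup>+z. indicator {z. 2 * R < norm z} z \<partial>difference_measure M)
     = (\<integral>\<^sup>+x. \<integral>\<^sup>+y. indicator {z. 2 * R < norm z} (x - y) \<partial>M \<partial>M)"
    by (rule nn_integral_difference_measure[OF fin sets]) measurable
  also have "\<dots> = (\<integral>\<^sup>+x. \<integral>\<^sup>+y. 0 \<partial>M \<partial>M)"
  proof (rule nn_integral_cong_AE, use R in eventually_elim)
    fix x :: 'a assume x: "norm x \<le> R"
    show "(\<integral>\<^sup>+y. indicator {z. 2 * R < norm z} (x - y) \<partial>M) = (\<integral>\<^sup>+y. 0 \<partial>M)"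
    proof (rule nn_integral_cong_AE, use R in eventually_elim)
      fix y :: 'a assume y: "norm y \<le> R"
      have "norm (x - y) \<le> 2 * R" using norm_triangle_ineq4[of x y] x y by simp
      then show "indicator {z. 2 * R < norm z} (x - y) = (0::ennreal)" by simp
    qed
  qed
  finally have "emeasure (difference_measure M) {z. 2 * R < norm z} = 0"
    by simp
  then show ?thesis
    by (intro AE_I[of _ _ "{z. 2 * R < norm z}"]) auto
qed

text \<open>After smoothing, the integral over \<open>z\<close> acts on a Gaussian of unit width centred at \<open>\<tau> z\<close>.
  Since \<open>|z| \<le> 2 R\<close>, that Gaussian is concentrated on \<open>|v| \<le> 2 R \<tau> + O(1)\<close>; half of its exponent is
  spent on the factor \<open>gauss (1 / (4 \<tau>^2)) v\<close>, which records this.\<close>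

lemma fourier_square_difference_le:
  fixes M :: "'a::euclidean_space measure"
  assumes M: "prob_space M" and sets [measurable_cong]: "sets M = sets borel"
    and R: "AE x in M. norm x \<le> R" and \<tau>: "\<tau> \<ge> 1"
  defines "M0 \<equiv> density M (\<lambda>x. ennreal (gauss (-1) x))"
  shows "(\<integral>\<^sup>+z. ennreal ((cmod (fourier_measure M (\<tau> *\<^sub>R z)))\<^sup>2) \<partial>difference_measure M)
    \<le> ennreal (exp (2 * pi * R\<^sup>2)) * (\<integral>\<^sup>+v. ennreal ((cmod (fourier_measure M0 v))\<^sup>2 * gauss (1 / (4 * \<tau>\<^sup>2)) v) *
        (\<integral>\<^sup>+z. ennreal (gauss (1 / 2) (\<tau> *\<^sub>R z - v)) \<partial>difference_measure M) \<partial>lborel)"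
proof -
  note M0 = finite_density_gauss[OF M sets R, folded M0_def]
    and sets0 = sets_density_gauss[OF M sets R, folded M0_def]
  interpret prob_space M by fact
  let ?N = "difference_measure M"
  interpret N: prob_space ?N by (rule prob_space_difference_measure) fact+
  interpret P: pair_sigma_finite lborel ?N ..
  note [measurable] = measurable_fourier_measure[OF M0 sets0] measurable_fourier_measure[OF finite_measure_axioms sets]
  let ?F = "\<lambda>v. (cmod (fourier_measure M0 v))\<^sup>2"
  let ?C = "exp (2 * pi * R\<^sup>2)"
  have key: "gauss 1 (\<tau> *\<^sub>R z - v) \<le> ?C * (gauss (1 / (4 * \<tau>\<^sup>2)) v * gauss (1 / 2) (\<tau> *\<^sub>R z - v))"
    if z: "norm z \<le> 2 * R" for z v :: 'a
  proof -
    let ?n = "norm (\<tau> *\<^sub>R z - v)"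
    have "norm v \<le> ?n + norm (\<tau> *\<^sub>R z)"
      using norm_triangle_ineq4[of "\<tau> *\<^sub>R z" "\<tau> *\<^sub>R z - v"] by simp
    also have "norm (\<tau> *\<^sub>R z) \<le> \<tau> * (2 * R)" using z \<tau> by (simp add: mult_left_mono)
    finally have "(norm v)\<^sup>2 \<le> (?n + \<tau> * (2 * R))\<^sup>2" by (intro power_mono) auto
    also have "\<dots> \<le> 2 * ?n\<^sup>2 + 2 * (\<tau> * (2 * R))\<^sup>2"
      using sum_squares_bound[of ?n "\<tau> * (2 * R)"] by (simp add: power2_sum)
    finally have "(norm v)\<^sup>2 / (4 * \<tau>\<^sup>2) \<le> (2 * ?n\<^sup>2 + 2 * (\<tau> * (2 * R))\<^sup>2) / (4 * \<tau>\<^sup>2)"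
      by (intro divide_right_mono) auto
    also have "\<dots> = ?n\<^sup>2 / (2 * \<tau>\<^sup>2) + 2 * R\<^sup>2"
      using \<tau> by (simp add: field_simps power_mult_distrib)
    also have "?n\<^sup>2 / (2 * \<tau>\<^sup>2) \<le> ?n\<^sup>2 / 2"
      using \<tau> by (intro divide_left_mono) (auto simp: one_le_power)
    finally have *: "(norm v)\<^sup>2 / (4 * \<tau>\<^sup>2) \<le> ?n\<^sup>2 / 2 + 2 * R\<^sup>2" by simp
    have "pi * ((norm v)\<^sup>2 / (4 * \<tau>\<^sup>2)) \<le> pi * (?n\<^sup>2 / 2 + 2 * R\<^sup>2)"
      by (rule mult_left_mono[OF *]) simp
    then show ?thesis
      by (simp add: gauss_def exp_add[symmetric] algebra_simps)
  qed
  have "(\<integral>\<^sup>+z. ennreal ((cmod (fourier_measure M (\<tau> *\<^sub>R z)))\<^sup>2) \<partial>?N)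
    \<le> (\<integral>\<^sup>+z. \<integral>\<^sup>+v. ennreal (?F v * gauss 1 (\<tau> *\<^sub>R z - v)) \<partial>lborel \<partial>?N)"
    unfolding M0_def by (intro nn_integral_mono fourier_measure_square_le_gauss_average[OF M sets R])
  also have "\<dots> \<le> (\<integral>\<^sup>+z. \<integral>\<^sup>+v. ennreal ?C * (ennreal (?F v * gauss (1 / (4 * \<tau>\<^sup>2)) v) * ennreal (gauss (1 / 2) (\<tau> *\<^sub>R z - v))) \<partial>lborel \<partial>?N)"
  proof (rule nn_integral_mono_AE, use AE_difference_measure_bounded[OF M sets R] in eventually_elim)
    fix z :: 'a assume z: "norm z \<le> 2 * R"
    show "(\<integral>\<^sup>+v. ennreal (?F v * gauss 1 (\<tau> *\<^sub>R z - v)) \<partial>lborel)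
      \<le> (\<integral>\<^sup>+v. ennreal ?C * (ennreal (?F v * gauss (1 / (4 * \<tau>\<^sup>2)) v) * ennreal (gauss (1 / 2) (\<tau> *\<^sub>R z - v))) \<partial>lborel)"
      using mult_left_mono[OF key[OF z], of "?F _"]
      by (intro nn_integral_mono) (auto simp: ennreal_mult[symmetric] mult_ac intro!: ennreal_leI)
  qed
  also have "\<dots> = ennreal ?C * (\<integral>\<^sup>+z. \<integral>\<^sup>+v. ennreal (?F v * gauss (1 / (4 * \<tau>\<^sup>2)) v) * ennreal (gauss (1 / 2) (\<tau> *\<^sub>R z - v)) \<partial>lborel \<partial>?N)"
    by (subst nn_integral_cmult, measurable, subst nn_integral_cmult) auto
  also have "\<dots> = ennreal ?C * (\<integral>\<^sup>+v. \<integral>\<^sup>+z. ennreal (?F v * gauss (1 / (4 * \<tau>\<^sup>2)) v) * ennreal (gauss (1 / 2) (\<tau> *\<^sub>R z - v)) \<partial>?N \<partial>lborel)"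
    by (subst P.Fubini') auto
  also have "\<dots> = ennreal ?C * (\<integral>\<^sup>+v. ennreal (?F v * gauss (1 / (4 * \<tau>\<^sup>2)) v) * (\<integral>\<^sup>+z. ennreal (gauss (1 / 2) (\<tau> *\<^sub>R z - v)) \<partial>?N) \<partial>lborel)"
    by (subst nn_integral_cmult) auto
  finally show ?thesis .
qed

section \<open>Square means from energies\<close>

lemma powr_mult_exp_minus_square_le:
  fixes x p q :: real
  assumes "x > 0" "p \<ge> 0" "q > 0"
  shows "x powr p * exp (- (q * x\<^sup>2)) \<le> exp (p\<^sup>2 / (4 * q))"
proof -
  have "ln x \<le> x" using ln_le_minus_one[of x] assms by simp
  then have "p * ln x \<le> p * x" using assms by (intro mult_left_mono) auto
  moreover have "p * x - q * x\<^sup>2 \<le> p\<^sup>2 / (4 * q)"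
  proof -
    have "0 \<le> (p - 2 * q * x)\<^sup>2" by simp
    then show ?thesis using assms by (simp add: field_simps power2_eq_square)
  qed
  ultimately show ?thesis
    using assms by (simp add: powr_def exp_add[symmetric])
qed

text \<open>For \<open>|v| \<ge> 1\<close> the Gaussian is at most a constant times \<open>(\<tau> / |v|)^(d - min s d)\<close>, which compares the
  Gaussian mean with the energy. The unit ball contributes a constant. The minimum appears because
  the unit ball already costs \<open>O(1)\<close>, so that nothing better than \<open>\<tau>^0\<close> can be expected.\<close>

lemma gauss_energy_le_of_power_energy:
  fixes G :: "'a::euclidean_space \<Rightarrow> real" and s c :: real
  assumes [measurable]: "G \<in> borel_measurable borel" and G: "\<And>v. 0 \<le> G v" "\<And>v. G v \<le> 1"
    and fin: "(\<integral>\<^sup>+v. ennreal (G v * norm v powr (s - real DIM('a))) \<partial>lborel) < \<infinity>"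
    and c: "c > 0"
  shows "\<exists>C\<ge>0. \<forall>\<tau>\<ge>1. (\<integral>\<^sup>+v. ennreal (G v * gauss (c / \<tau>\<^sup>2) v) \<partial>lborel)
            \<le> ennreal (C * \<tau> powr (real DIM('a) - min s (real DIM('a))))"
proof -
  let ?d = "real DIM('a)"
  define p where "p = ?d - min s ?d"
  have p: "p \<ge> 0" by (simp add: p_def)
  define C0 where "C0 = exp (p\<^sup>2 / (4 * (pi * c)))"
  define J where "J = enn2real (\<integral>\<^sup>+v. ennreal (G v * norm v powr (s - ?d)) \<partial>lborel)"
  have J: "(\<integral>\<^sup>+v. ennreal (G v * norm v powr (s - ?d)) \<partial>lborel) = ennreal J" "J \<ge> 0"
    using fin by (simp_all add: J_def)
  define V where "V = measure lborel (cball (0::'a) 1)"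
  have V: "emeasure lborel (cball (0::'a) 1) = ennreal V" "V \<ge> 0"
    using emeasure_lborel_cball_finite[of "0::'a" 1] by (simp_all add: V_def emeasure_eq_ennreal_measure)
  show ?thesis
  proof (intro exI[of _ "V + C0 * J"] conjI allI impI)
    show "0 \<le> V + C0 * J" using V J by (simp add: C0_def)
    fix \<tau> :: real assume \<tau>: "\<tau> \<ge> 1"
    have key: "G v * gauss (c / \<tau>\<^sup>2) v \<le> indicator (cball 0 1) v + C0 * \<tau> powr p * (G v * norm v powr (s - ?d))"
      for v :: 'a
    proof (cases "norm v \<le> 1")
      case True
      have "G v * gauss (c / \<tau>\<^sup>2) v \<le> 1 * 1"
        using G[of v] c by (intro mult_mono gauss_le_1) auto
      then show ?thesis using True G[of v] by (simp add: C0_def add_increasing2)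
    next
      case False
      then have n: "norm v > 1" by simp
      have "(norm v / \<tau>) powr p * exp (- (pi * c * (norm v / \<tau>)\<^sup>2)) \<le> C0"
        unfolding C0_def using n \<tau> c p by (intro powr_mult_exp_minus_square_le divide_pos_pos) auto
      then have 1: "norm v powr p * gauss (c / \<tau>\<^sup>2) v \<le> C0 * \<tau> powr p"
        using \<tau> n by (simp add: gauss_def powr_divide power_divide field_simps)
      have "gauss (c / \<tau>\<^sup>2) v = norm v powr p * gauss (c / \<tau>\<^sup>2) v * norm v powr (- p)"
        using n by (subst mult.commute, subst mult.assoc[symmetric], subst powr_add[symmetric]) auto
      also have "\<dots> \<le> (C0 * \<tau> powr p) * norm v powr (- p)"
        by (intro mult_right_mono 1) simp
      also have "\<dots> \<le> (C0 * \<tau> powr p) * norm v powr (s - ?d)"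
        using n by (intro mult_left_mono powr_mono) (auto simp: p_def C0_def)
      finally have "G v * gauss (c / \<tau>\<^sup>2) v \<le> G v * ((C0 * \<tau> powr p) * norm v powr (s - ?d))"
        using G[of v] by (intro mult_left_mono) auto
      then show ?thesis by (simp add: mult_ac add_increasing)
    qed
    have "(\<integral>\<^sup>+v. ennreal (G v * gauss (c / \<tau>\<^sup>2) v) \<partial>lborel)
      \<le> (\<integral>\<^sup>+v. indicator (cball 0 1) v + ennreal (C0 * \<tau> powr p) * ennreal (G v * norm v powr (s - ?d)) \<partial>lborel)"
    proof (intro nn_integral_mono)
      fix v :: 'a
      have "ennreal (G v * gauss (c / \<tau>\<^sup>2) v) \<le> ennreal (indicator (cball 0 1) v + C0 * \<tau> powr p * (G v * norm v powr (s - ?d)))"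
        by (rule ennreal_leI[OF key])
      also have "\<dots> = indicator (cball 0 1) v + ennreal (C0 * \<tau> powr p) * ennreal (G v * norm v powr (s - ?d))"
        using G[of v] by (subst ennreal_plus) (auto simp: C0_def ennreal_mult ennreal_indicator)
      finally show "ennreal (G v * gauss (c / \<tau>\<^sup>2) v) \<le> indicator (cball 0 1) v + ennreal (C0 * \<tau> powr p) * ennreal (G v * norm v powr (s - ?d))" .
    qed
    also have "\<dots> = ennreal V + ennreal (C0 * \<tau> powr p) * ennreal J"
      by (subst nn_integral_add) (auto simp: V(1) J(1)[symmetric] nn_integral_cmult intro!: borel_measurable_indicator)
    also have "\<dots> = ennreal (V * 1 + C0 * \<tau> powr p * J)"
      using V J by (simp add: C0_def ennreal_mult ennreal_plus)
    also have "\<dots> \<le> ennreal (V * \<tau> powr p + C0 * \<tau> powr p * J)"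
      using V \<tau> p by (intro ennreal_leI add_right_mono mult_left_mono) (auto simp: ge_one_powr_ge_zero)
    also have "V * \<tau> powr p + C0 * \<tau> powr p * J = (V + C0 * J) * \<tau> powr p" by (simp add: algebra_simps)
    finally show "(\<integral>\<^sup>+v. ennreal (G v * gauss (c / \<tau>\<^sup>2) v) \<partial>lborel)
            \<le> ennreal ((V + C0 * J) * \<tau> powr (real DIM('a) - min s (real DIM('a))))" by (simp add: p_def)
  qed
qed

text \<open>The inner integral over \<open>z\<close> is bounded uniformly in \<open>v\<close> by the mass estimate for Gaussian balls,
  which produces the factor \<open>\<tau>^(-d) E\<close>; the remaining integral over \<open>v\<close> is a square mean of the
  transform of the weighted measure and produces the second factor \<open>E\<close>.\<close>

lemma fourier_square_difference_le_square_energy: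
  fixes M :: "'a::euclidean_space measure"
  assumes M: "prob_space M" and sets [measurable_cong]: "sets M = sets borel"
    and R: "AE x in M. norm x \<le> R"
  defines "E \<equiv> \<lambda>a. \<integral>\<^sup>+v. ennreal ((cmod (fourier_measure M v))\<^sup>2 * gauss a v) \<partial>lborel"
  shows "\<exists>C\<ge>0. \<forall>\<tau>\<ge>1. (\<integral>\<^sup>+z. ennreal ((cmod (fourier_measure M (\<tau> *\<^sub>R z)))\<^sup>2) \<partial>difference_measure M)
    \<le> ennreal (C / \<tau> ^ DIM('a)) * (E (1 / (4 * \<tau>\<^sup>2)))\<^sup>2"
proof -
  define M0 where "M0 = density M (\<lambda>x. ennreal (gauss (-1) x))"
  note M0 = finite_density_gauss[OF M sets R, folded M0_def]
    and sets0 = sets_density_gauss[OF M sets R, folded M0_def]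
    and dom = dominated_density_gauss[OF M sets R, folded M0_def]
  interpret prob_space M by fact
  note Mf = finite_measure_axioms
  let ?N = "difference_measure M"
  have N: "finite_measure ?N" by (rule finite_measure_difference_measure[OF Mf sets])
  note [measurable] = measurable_fourier_measure[OF M0 sets0] measurable_fourier_measure[OF Mf sets]
  let ?D = "exp (pi * R\<^sup>2)" and ?C = "exp (2 * pi * R\<^sup>2)"
  show ?thesis
  proof (intro exI[of _ "?C * sqrt 2 ^ DIM('a) * (?D * ?D)"] conjI allI impI)
    fix \<tau> :: real assume \<tau>: "\<tau> \<ge> 1"
    let ?b = "1 / (4 * \<tau>\<^sup>2)"
    have P: "(\<integral>\<^sup>+z. ennreal (gauss (1 / 2) (\<tau> *\<^sub>R z - v)) \<partial>?N) \<le> ennreal ((sqrt 2 / \<tau>) ^ DIM('a)) * E ?b" for v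
    proof -
      define a where "a = 2 / \<tau>\<^sup>2"
      have a: "a > 0" "sqrt a = sqrt 2 / \<tau>" using \<tau> by (auto simp: a_def real_sqrt_divide)
      have eq: "gauss (1 / 2) (\<tau> *\<^sub>R z - v) = gauss (1 / a) ((1 / \<tau>) *\<^sub>R v - z)" for z
      proof -
        have "\<tau> *\<^sub>R z - v = (- \<tau>) *\<^sub>R ((1 / \<tau>) *\<^sub>R v - z)" using \<tau> by (simp add: scaleR_diff_right)
        then show ?thesis by (simp only: gauss_scaleR) (simp add: a_def)
      qed
      have "(\<integral>\<^sup>+z. ennreal (gauss (1 / 2) (\<tau> *\<^sub>R z - v)) \<partial>?N)
        = ennreal ((sqrt a) ^ DIM('a)) * (ennreal ((1 / sqrt a) ^ DIM('a)) * (\<integral>\<^sup>+z. ennreal (gauss (1 / a) ((1 / \<tau>) *\<^sub>R v - z)) \<partial>?N))"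
        using a(1) unfolding eq
        by (simp add: mult.assoc[symmetric] ennreal_mult[symmetric] power_mult_distrib[symmetric] del: power_divide)
      also have "\<dots> \<le> ennreal ((sqrt a) ^ DIM('a)) * (\<integral>\<^sup>+v. ennreal (cmod (fourier_measure ?N v) * gauss a v) \<partial>lborel)"
        by (intro mult_left_mono gauss_mass_le_fourier N a) auto
      also have "(\<integral>\<^sup>+v. ennreal (cmod (fourier_measure ?N v) * gauss a v) \<partial>lborel) = E a"
        unfolding E_def fourier_difference_measure[OF Mf sets] by (simp add: norm_power)
      also have "E a \<le> E ?b"
        unfolding E_def using \<tau>
        by (intro nn_integral_mono ennreal_leI mult_left_mono gauss_antimono) (auto simp: a_def field_simps)
      finally show ?thesis by (simp add: a(2) mult_left_mono)
    qed
    have E0: "(\<integral>\<^sup>+v. ennreal ((cmod (fourier_measure M0 v))\<^sup>2 * gauss ?b v) \<partial>lborel) \<le> ennreal ?D * ennreal ?D * E ?b"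
      unfolding E_def using \<tau> by (intro fourier_gauss_energy_dominated[OF M0 sets0 Mf sets dom]) auto
    have "(\<integral>\<^sup>+z. ennreal ((cmod (fourier_measure M (\<tau> *\<^sub>R z)))\<^sup>2) \<partial>?N)
      \<le> ennreal ?C * (\<integral>\<^sup>+v. ennreal ((cmod (fourier_measure M0 v))\<^sup>2 * gauss ?b v) *
        (\<integral>\<^sup>+z. ennreal (gauss (1 / 2) (\<tau> *\<^sub>R z - v)) \<partial>?N) \<partial>lborel)"
      unfolding M0_def by (rule fourier_square_difference_le[OF M sets R \<tau>])
    also have "\<dots> \<le> ennreal ?C * (\<integral>\<^sup>+v. ennreal ((cmod (fourier_measure M0 v))\<^sup>2 * gauss ?b v) *
        (ennreal ((sqrt 2 / \<tau>) ^ DIM('a)) * E ?b) \<partial>lborel)"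
      by (intro mult_left_mono nn_integral_mono P) auto
    also have "\<dots> = ennreal ?C * ((\<integral>\<^sup>+v. ennreal ((cmod (fourier_measure M0 v))\<^sup>2 * gauss ?b v) \<partial>lborel) *
        (ennreal ((sqrt 2 / \<tau>) ^ DIM('a)) * E ?b))"
      by (subst nn_integral_multc) auto
    also have "\<dots> \<le> ennreal ?C * ((ennreal ?D * ennreal ?D * E ?b) * (ennreal ((sqrt 2 / \<tau>) ^ DIM('a)) * E ?b))"
      by (intro mult_left_mono mult_right_mono E0) auto
    also have "\<dots> = (ennreal ?C * (ennreal ?D * ennreal ?D) * ennreal ((sqrt 2 / \<tau>) ^ DIM('a))) * (E ?b)\<^sup>2"
      by (simp add: power2_eq_square mult_ac)
    also have "ennreal ?C * (ennreal ?D * ennreal ?D) * ennreal ((sqrt 2 / \<tau>) ^ DIM('a))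
        = ennreal ((?C * sqrt 2 ^ DIM('a) * (?D * ?D)) / \<tau> ^ DIM('a))"
      using \<tau> by (simp add: ennreal_mult[symmetric] power_divide mult_ac)
    finally show "(\<integral>\<^sup>+z. ennreal ((cmod (fourier_measure M (\<tau> *\<^sub>R z)))\<^sup>2) \<partial>?N)
      \<le> ennreal ((?C * sqrt 2 ^ DIM('a) * (?D * ?D)) / \<tau> ^ DIM('a)) * (E ?b)\<^sup>2" .
  qed simp
qed

lemma ennreal_mult_le_weighted_squares:
  fixes x y l :: real
  assumes "0 \<le> x" "0 \<le> y" "0 < l"
  shows "ennreal x * ennreal y \<le> ennreal l * ennreal (x\<^sup>2) + ennreal (1 / l) * ennreal (y\<^sup>2)"
proof -
  have "0 \<le> (l * x - y)\<^sup>2" by simp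
  then have "2 * l * (x * y) \<le> l\<^sup>2 * x\<^sup>2 + y\<^sup>2" by (simp add: power2_diff power_mult_distrib algebra_simps)
  moreover have "0 \<le> l * (x * y)" using assms by simp
  ultimately have "l * (x * y) \<le> l\<^sup>2 * x\<^sup>2 + y\<^sup>2" by linarith
  then have "x * y \<le> l * x\<^sup>2 + 1 / l * y\<^sup>2" using assms by (simp add: field_simps power2_eq_square)
  then show ?thesis
    using assms by (simp add: ennreal_mult[symmetric] ennreal_plus[symmetric] ennreal_leI del: ennreal_plus)
qed

text \<open>Here the inner integral \<open>P(v)\<close> is measured in \<open>L^2\<close> instead of the supremum norm: both \<open>P\<close>
  and \<open>|F0|^2\<close> have square integrals controlled by \<open>E\<close>, the former with an additional factor
  \<open>\<tau>^(-d)\<close>. The inequality between products and weighted squares replaces the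
  Cauchy--Schwarz inequality; its weight \<open>\<tau>^(-d/2)\<close> balances the two terms.\<close>

lemma fourier_square_difference_le_fourth_energy:
  fixes M :: "'a::euclidean_space measure"
  assumes M: "prob_space M" and sets [measurable_cong]: "sets M = sets borel"
    and R: "AE x in M. norm x \<le> R"
  defines "E \<equiv> \<lambda>a. \<integral>\<^sup>+v. ennreal ((cmod (fourier_measure M v)) ^ 4 * gauss a v) \<partial>lborel"
  shows "\<exists>C\<ge>0. \<forall>\<tau>\<ge>1. (\<integral>\<^sup>+z. ennreal ((cmod (fourier_measure M (\<tau> *\<^sub>R z)))\<^sup>2) \<partial>difference_measure M)
    \<le> ennreal (C * \<tau> powr (- real DIM('a) / 2)) * E (1 / (4 * \<tau>\<^sup>2))"
proof -
  define M0 where "M0 = density M (\<lambda>x. ennreal (gauss (-1) x))"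
  note M0 = finite_density_gauss[OF M sets R, folded M0_def]
    and sets0 = sets_density_gauss[OF M sets R, folded M0_def]
    and dom = dominated_density_gauss[OF M sets R, folded M0_def]
  interpret prob_space M by fact
  note Mf = finite_measure_axioms
  let ?N = "difference_measure M" and ?Q = "difference_measure M0"
  have Np: "prob_space ?N" by (rule prob_space_difference_measure[OF M sets])
  then interpret N: prob_space ?N .
  note N = N.finite_measure_axioms
  have N0: "finite_measure ?Q" by (rule finite_measure_difference_measure[OF M0 sets0])
  note [measurable] = measurable_fourier_measure[OF M0 sets0] measurable_fourier_measure[OF Mf sets]
  let ?D = "exp (pi * R\<^sup>2)" and ?C = "exp (2 * pi * R\<^sup>2)"
  have FN: "(cmod (fourier_measure ?N v))\<^sup>2 = cmod (fourier_measure M v) ^ 4" for v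
    unfolding fourier_difference_measure[OF Mf sets] by (simp add: norm_power power_mult[symmetric])
  have FN0: "(cmod (fourier_measure ?Q v))\<^sup>2 = cmod (fourier_measure M0 v) ^ 4" for v
    unfolding fourier_difference_measure[OF M0 sets0] by (simp add: norm_power power_mult[symmetric])
  have EN: "E a = (\<integral>\<^sup>+v. ennreal ((cmod (fourier_measure ?N v))\<^sup>2 * gauss a v) \<partial>lborel)" for a
    unfolding E_def FN ..
  show ?thesis
  proof (intro exI[of _ "?C * (?D ^ 4 + 2 ^ DIM('a))"] conjI allI impI)
    fix \<tau> :: real assume \<tau>: "\<tau> \<ge> 1"
    let ?b = "1 / (4 * \<tau>\<^sup>2)"
    define P where "P v = (\<integral>z. gauss (1 / 2) (\<tau> *\<^sub>R z - v) \<partial>?N)" for v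
    have P0: "0 \<le> P v" for v by (simp add: P_def)
    have P: "(\<integral>\<^sup>+z. ennreal (gauss (1 / 2) (\<tau> *\<^sub>R z - v)) \<partial>?N) = ennreal (P v)" for v
      unfolding P_def
      by (rule nn_integral_eq_integral, rule N.integrable_const_bound[of _ 1]) (auto simp: gauss_le_1)
    have [measurable]: "P \<in> borel_measurable borel" unfolding P_def[abs_def] by measurable
    have "(\<integral>\<^sup>+v. ennreal ((P v)\<^sup>2) \<partial>lborel)
      = (\<integral>\<^sup>+v. \<integral>\<^sup>+z. \<integral>\<^sup>+w. ennreal (gauss (1 / 2) (\<tau> *\<^sub>R z - v) * gauss (1 / 2) (\<tau> *\<^sub>R w - v)) \<partial>?N \<partial>?N \<partial>lborel)"
    proof (intro nn_integral_cong)
      fix v :: 'a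
      have "ennreal ((P v)\<^sup>2) = (\<integral>\<^sup>+z. ennreal (gauss (1 / 2) (\<tau> *\<^sub>R z - v)) \<partial>?N) * ennreal (P v)"
        unfolding P using P0[of v] by (simp add: power2_eq_square ennreal_mult)
      also have "\<dots> = (\<integral>\<^sup>+z. ennreal (gauss (1 / 2) (\<tau> *\<^sub>R z - v)) * ennreal (P v) \<partial>?N)"
        by (rule nn_integral_multc[symmetric]) measurable
      also have "\<dots> = (\<integral>\<^sup>+z. \<integral>\<^sup>+w. ennreal (gauss (1 / 2) (\<tau> *\<^sub>R z - v) * gauss (1 / 2) (\<tau> *\<^sub>R w - v)) \<partial>?N \<partial>?N)"
        unfolding P[symmetric] by (subst nn_integral_cmult[symmetric]) (auto simp: ennreal_mult)
      finally show "ennreal ((P v)\<^sup>2) = \<dots>" .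
    qed
    also have "\<dots> = (\<integral>\<^sup>+z. \<integral>\<^sup>+w. \<integral>\<^sup>+v. ennreal (gauss (1 / 2) (\<tau> *\<^sub>R z - v) * gauss (1 / 2) (\<tau> *\<^sub>R w - v)) \<partial>lborel \<partial>?N \<partial>?N)"
    proof -
      interpret Q: pair_sigma_finite "lborel :: 'a measure" ?N ..
      show ?thesis
        by (subst Q.Fubini'[symmetric], measurable, subst Q.Fubini'[symmetric]) auto
    qed
    also have "\<dots> = (\<integral>\<^sup>+z. \<integral>\<^sup>+w. ennreal (gauss (\<tau>\<^sup>2 / 4) (z - w)) \<partial>?N \<partial>?N)"
    proof (intro nn_integral_cong)
      fix z w :: 'a
      \<comment> \<open>The product of two Gaussians of equal width is a Gaussian about the midpoint of their centres.\<close>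
      define m where "m = (\<tau> / 2) *\<^sub>R (z + w)"
      have "gauss (1 / 2) (\<tau> *\<^sub>R z - v) * gauss (1 / 2) (\<tau> *\<^sub>R w - v) = gauss (\<tau>\<^sup>2 / 4) (z - w) * gauss 1 (m - v)" for v
      proof -
        have *: "(norm (\<tau> *\<^sub>R z - v))\<^sup>2 / 2 + (norm (\<tau> *\<^sub>R w - v))\<^sup>2 / 2 = \<tau>\<^sup>2 / 4 * (norm (z - w))\<^sup>2 + (norm (m - v))\<^sup>2"
          unfolding m_def power2_norm_eq_inner
          by (simp add: inner_simps inner_commute field_simps power2_eq_square)
        show ?thesis
          using arg_cong[OF *, of "\<lambda>t. exp (- (pi * t))"]
          by (simp add: gauss_def exp_add[symmetric] distrib_left)
      qed
      then have "(\<integral>\<^sup>+v. ennreal (gauss (1 / 2) (\<tau> *\<^sub>R z - v) * gauss (1 / 2) (\<tau> *\<^sub>R w - v)) \<partial>lborel)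
         = (\<integral>\<^sup>+v. ennreal (gauss (\<tau>\<^sup>2 / 4) (z - w)) * ennreal (gauss 1 (m - v)) \<partial>lborel)"
        by (simp add: ennreal_mult)
      also have "\<dots> = ennreal (gauss (\<tau>\<^sup>2 / 4) (z - w)) * (\<integral>\<^sup>+v. ennreal (gauss 1 (m - v)) \<partial>lborel)"
        by (rule nn_integral_cmult) measurable
      also have "(\<integral>\<^sup>+v. ennreal (gauss 1 (m - v)) \<partial>lborel) = 1"
        by (subst nn_integral_lborel_reflect) (auto simp: nn_integral_gauss)
      finally show "(\<integral>\<^sup>+v. ennreal (gauss (1 / 2) (\<tau> *\<^sub>R z - v) * gauss (1 / 2) (\<tau> *\<^sub>R w - v)) \<partial>lborel)
         = ennreal (gauss (\<tau>\<^sup>2 / 4) (z - w))" by simp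
    qed
    also have "\<dots> = (\<integral>\<^sup>+u. ennreal (gauss (\<tau>\<^sup>2 / 4) u) \<partial>difference_measure ?N)"
      by (rule nn_integral_difference_measure[symmetric, OF N]) auto
    also have "\<dots> = ennreal ((2 / \<tau>) ^ DIM('a)) * E (4 / \<tau>\<^sup>2)"
    proof -
      have "E (4 / \<tau>\<^sup>2) = ennreal ((1 / sqrt (4 / \<tau>\<^sup>2)) ^ DIM('a)) * (\<integral>\<^sup>+u. ennreal (gauss (1 / (4 / \<tau>\<^sup>2)) u) \<partial>difference_measure ?N)"
        unfolding EN using \<tau> by (intro fourier_gauss_energy N) auto
      also have "1 / sqrt (4 / \<tau>\<^sup>2) = \<tau> / 2" using \<tau> by (simp add: real_sqrt_divide)
      finally have "ennreal ((2 / \<tau>) ^ DIM('a)) * E (4 / \<tau>\<^sup>2) = ennreal ((2 / \<tau>) ^ DIM('a) * (\<tau> / 2) ^ DIM('a)) * (\<integral>\<^sup>+u. ennreal (gauss (\<tau>\<^sup>2 / 4) u) \<partial>difference_measure ?N)"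
        using \<tau> by (simp add: mult.assoc[symmetric] ennreal_mult[symmetric])
      also have "(2 / \<tau>) ^ DIM('a) * (\<tau> / 2) ^ DIM('a) = 1"
        using \<tau> by (simp add: power_mult_distrib[symmetric])
      finally show ?thesis by simp
    qed
    also have "\<dots> \<le> ennreal ((2 / \<tau>) ^ DIM('a)) * E ?b"
    proof (intro mult_left_mono)
      show "E (4 / \<tau>\<^sup>2) \<le> E ?b"
        unfolding E_def using \<tau>
        by (intro nn_integral_mono ennreal_leI mult_left_mono gauss_antimono) (auto simp: field_simps)
    qed simp
    finally have P2: "(\<integral>\<^sup>+v. ennreal ((P v)\<^sup>2) \<partial>lborel) \<le> ennreal ((2 / \<tau>) ^ DIM('a)) * E ?b" .
    have E0: "(\<integral>\<^sup>+v. ennreal (((cmod (fourier_measure M0 v))\<^sup>2)\<^sup>2 * gauss ?b v) \<partial>lborel) \<le> ennreal (?D ^ 4) * E ?b"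
    proof -
      have "(\<integral>\<^sup>+v. ennreal ((cmod (fourier_measure ?Q v))\<^sup>2 * gauss ?b v) \<partial>lborel)
        \<le> (ennreal ?D * ennreal ?D) * (ennreal ?D * ennreal ?D) * E ?b"
        unfolding EN using \<tau>
        by (intro fourier_gauss_energy_dominated[OF N0 _ N] dominated_difference_measure[OF M0 sets0 Mf sets dom]) auto
      moreover have "(ennreal ?D * ennreal ?D) * (ennreal ?D * ennreal ?D) = ennreal (?D ^ 4)"
        by (simp add: ennreal_mult[symmetric] power4_eq_xxxx mult.assoc)
      moreover have "((cmod (fourier_measure M0 v))\<^sup>2)\<^sup>2 = (cmod (fourier_measure ?Q v))\<^sup>2" for v
        unfolding FN0 by (simp add: power_mult[symmetric])
      ultimately show ?thesis by simp
    qed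
    define l where "l = \<tau> powr (- real DIM('a) / 2)"
    have l: "l > 0" using \<tau> by (simp add: l_def)
    have l2: "l * l = 1 / \<tau> ^ DIM('a)"
      using \<tau> by (simp add: l_def powr_add[symmetric] powr_minus powr_realpow field_simps)
    have "(\<integral>\<^sup>+z. ennreal ((cmod (fourier_measure M (\<tau> *\<^sub>R z)))\<^sup>2) \<partial>?N)
      \<le> ennreal ?C * (\<integral>\<^sup>+v. ennreal ((cmod (fourier_measure M0 v))\<^sup>2 * gauss ?b v) * ennreal (P v) \<partial>lborel)"
      unfolding M0_def P[symmetric] by (rule fourier_square_difference_le[OF M sets R \<tau>])
    also have "\<dots> \<le> ennreal ?C * (\<integral>\<^sup>+v. ennreal l * ennreal (((cmod (fourier_measure M0 v))\<^sup>2)\<^sup>2 * gauss ?b v) + ennreal (1 / l) * ennreal ((P v)\<^sup>2) \<partial>lborel)"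
    proof (intro mult_left_mono nn_integral_mono)
      fix v :: 'a
      let ?x = "(cmod (fourier_measure M0 v))\<^sup>2 * gauss ?b v"
      have g1: "gauss ?b v \<le> 1" using \<tau> by (simp add: gauss_le_1)
      have "ennreal ?x * ennreal (P v) \<le> ennreal l * ennreal (?x\<^sup>2) + ennreal (1 / l) * ennreal ((P v)\<^sup>2)"
        using P0 l by (intro ennreal_mult_le_weighted_squares) auto
      also have "?x\<^sup>2 \<le> ((cmod (fourier_measure M0 v))\<^sup>2)\<^sup>2 * gauss ?b v"
      proof -
        have "(gauss ?b v)\<^sup>2 \<le> gauss ?b v"
          using mult_left_mono[OF g1, of "gauss ?b v"] by (simp add: power2_eq_square)
        then show ?thesis unfolding power_mult_distrib by (intro mult_left_mono) auto
      qed
      finally show "ennreal ?x * ennreal (P v) \<le> ennreal l * ennreal (((cmod (fourier_measure M0 v))\<^sup>2)\<^sup>2 * gauss ?b v) + ennreal (1 / l) * ennreal ((P v)\<^sup>2)"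
        by (simp add: add_right_mono mult_left_mono ennreal_leI)
    qed simp
    also have "\<dots> = ennreal ?C * (ennreal l * (\<integral>\<^sup>+v. ennreal (((cmod (fourier_measure M0 v))\<^sup>2)\<^sup>2 * gauss ?b v) \<partial>lborel) + ennreal (1 / l) * (\<integral>\<^sup>+v. ennreal ((P v)\<^sup>2) \<partial>lborel))"
      by (simp add: nn_integral_add nn_integral_cmult)
    also have "\<dots> \<le> ennreal ?C * (ennreal l * (ennreal (?D ^ 4) * E ?b) + ennreal (1 / l) * (ennreal ((2 / \<tau>) ^ DIM('a)) * E ?b))"
      by (intro mult_left_mono add_mono E0 P2) auto
    also have "\<dots> = (ennreal ?C * (ennreal l * ennreal (?D ^ 4) + ennreal (1 / l) * ennreal ((2 / \<tau>) ^ DIM('a)))) * E ?b"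
      by (simp add: algebra_simps)
    also have "ennreal ?C * (ennreal l * ennreal (?D ^ 4) + ennreal (1 / l) * ennreal ((2 / \<tau>) ^ DIM('a)))
       = ennreal (?C * (l * ?D ^ 4 + 1 / l * (2 / \<tau>) ^ DIM('a)))"
      using l \<tau> by (simp add: ennreal_mult[symmetric] ennreal_plus[symmetric] del: ennreal_plus)
    also have "1 / l * (2 / \<tau>) ^ DIM('a) = l * 2 ^ DIM('a)"
      using l \<tau> l2 by (simp add: power_divide field_simps)
    also have "?C * (l * ?D ^ 4 + l * 2 ^ DIM('a)) = ?C * (?D ^ 4 + 2 ^ DIM('a)) * \<tau> powr (- real DIM('a) / 2)"
      by (simp add: l_def algebra_simps)
    finally show "(\<integral>\<^sup>+z. ennreal ((cmod (fourier_measure M (\<tau> *\<^sub>R z)))\<^sup>2) \<partial>?N)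
      \<le> ennreal (?C * (?D ^ 4 + 2 ^ DIM('a)) * \<tau> powr (- real DIM('a) / 2)) * E ?b" .
  qed simp
qed

section \<open>Decay of the Fourier transform averaged over differences\<close>

text \<open>The Cauchy--Schwarz inequality for the probability measure \<open>N\<close>, again in the form of weighted
  squares.\<close>

lemma fourier_average_le_of_square:
  fixes M N :: "'a::euclidean_space measure"
  assumes N: "prob_space N" and sets_N [measurable_cong]: "sets N = sets borel"
    and M: "finite_measure M" and sets [measurable_cong]: "sets M = sets borel"
    and le: "(\<integral>\<^sup>+z. ennreal ((cmod (fourier_measure M (\<tau> *\<^sub>R z)))\<^sup>2) \<partial>N) \<le> ennreal (C * \<tau> powr (- (2 * t)))"
    and \<tau>: "\<tau> > 0" and C: "C \<ge> 0"
  shows "(\<integral>\<^sup>+z. ennreal (cmod (fourier_measure M (\<tau> *\<^sub>R z))) \<partial>N) \<le> ennreal ((1 + C) * \<tau> powr (- t))"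
proof -
  interpret N: prob_space N by fact
  note [measurable] = measurable_fourier_measure[OF M sets]
  let ?F = "\<lambda>z. cmod (fourier_measure M (\<tau> *\<^sub>R z))"
  define l where "l = \<tau> powr (- t)"
  have l: "l > 0" using \<tau> by (simp add: l_def)
  have "(\<integral>\<^sup>+z. ennreal (?F z) \<partial>N) \<le> (\<integral>\<^sup>+z. ennreal l + ennreal (1 / l) * ennreal ((?F z)\<^sup>2) \<partial>N)"
  proof (intro nn_integral_mono)
    fix z
    have "ennreal 1 * ennreal (?F z) \<le> ennreal l * ennreal (1\<^sup>2) + ennreal (1 / l) * ennreal ((?F z)\<^sup>2)"
      by (rule ennreal_mult_le_weighted_squares) (use l in auto)
    then show "ennreal (?F z) \<le> ennreal l + ennreal (1 / l) * ennreal ((?F z)\<^sup>2)" by simp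
  qed
  also have "\<dots> = ennreal l + ennreal (1 / l) * (\<integral>\<^sup>+z. ennreal ((?F z)\<^sup>2) \<partial>N)"
    by (simp add: nn_integral_add nn_integral_cmult N.emeasure_space_1)
  also have "\<dots> \<le> ennreal l + ennreal (1 / l) * ennreal (C * \<tau> powr (- (2 * t)))"
    by (intro add_left_mono mult_left_mono le) auto
  also have "\<dots> = ennreal (l + 1 / l * (C * \<tau> powr (- (2 * t))))"
    using l C by (simp add: ennreal_mult[symmetric] ennreal_plus[symmetric] del: ennreal_plus)
  also have "\<tau> powr (- (2 * t)) = l * l" by (simp add: l_def powr_add[symmetric])
  also have "l + 1 / l * (C * (l * l)) = (1 + C) * l" using l by (simp add: field_simps)
  finally show ?thesis by (simp add: l_def)
qed

text \<open>With \<open>e = min s d\<close> the two factors \<open>E\<close> are \<open>O(\<tau>^(d - e))\<close> each, so the square mean is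
  \<open>O(\<tau>^(d - 2 e))\<close>, and its square root has the stated exponent.\<close>

lemma fourier_average_decay_sobolev:
  fixes M :: "'a::euclidean_space measure" and s :: real
  assumes M: "prob_space M" and sets [measurable_cong]: "sets M = sets borel"
    and R: "AE x in M. norm x \<le> R"
    and fin: "(\<integral>\<^sup>+v. ennreal ((cmod (fourier_measure M v))\<^sup>2 * norm v powr (s - real DIM('a))) \<partial>lborel) < \<infinity>"
  shows "\<exists>C\<ge>0. \<forall>\<tau>\<ge>1. (\<integral>\<^sup>+z. ennreal (cmod (fourier_measure M (\<tau> *\<^sub>R z))) \<partial>difference_measure M)
    \<le> ennreal (C * \<tau> powr (- (min s (real DIM('a)) - real DIM('a) / 2)))"
proof -
  let ?d = "real DIM('a)"
  define e where "e = min s ?d"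
  interpret prob_space M by fact
  note Mf = finite_measure_axioms
  note N = prob_space_difference_measure[OF M sets]
  note [measurable] = measurable_fourier_measure[OF Mf sets]
  define E where "E a = (\<integral>\<^sup>+v. ennreal ((cmod (fourier_measure M v))\<^sup>2 * gauss a v) \<partial>lborel)" for a
  obtain C1 where C1: "C1 \<ge> 0" "\<And>\<tau>. \<tau> \<ge> 1 \<Longrightarrow> (\<integral>\<^sup>+z. ennreal ((cmod (fourier_measure M (\<tau> *\<^sub>R z)))\<^sup>2) \<partial>difference_measure M)
    \<le> ennreal (C1 / \<tau> ^ DIM('a)) * (E (1 / (4 * \<tau>\<^sup>2)))\<^sup>2"
    using fourier_square_difference_le_square_energy[OF M sets R] unfolding E_def by blast
  obtain C2 where C2: "C2 \<ge> 0" "\<And>\<tau>. \<tau> \<ge> 1 \<Longrightarrow> E ((1 / 4) / \<tau>\<^sup>2) \<le> ennreal (C2 * \<tau> powr (?d - e))"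
    using gauss_energy_le_of_power_energy[OF _ _ _ fin, of "1 / 4"] norm_fourier_measure_le_1[OF M sets]
    unfolding E_def e_def by (auto simp: power_le_one)
  show ?thesis
  proof (intro exI[of _ "1 + C1 * C2\<^sup>2"] conjI allI impI)
    fix \<tau> :: real assume \<tau>: "\<tau> \<ge> 1"
    note C1(2)[OF \<tau>]
    also have "ennreal (C1 / \<tau> ^ DIM('a)) * (E (1 / (4 * \<tau>\<^sup>2)))\<^sup>2 \<le> ennreal (C1 / \<tau> ^ DIM('a)) * (ennreal (C2 * \<tau> powr (?d - e)))\<^sup>2"
      using C2(2)[OF \<tau>] by (intro mult_left_mono power_mono) auto
    also have "\<dots> = ennreal (C1 / \<tau> ^ DIM('a) * (C2 * \<tau> powr (?d - e))\<^sup>2)"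
      using C1 C2 \<tau> by (subst ennreal_mult) (auto simp: ennreal_power)
    also have "C1 / \<tau> ^ DIM('a) * (C2 * \<tau> powr (?d - e))\<^sup>2 = C1 * C2\<^sup>2 * \<tau> powr (- (2 * (e - ?d / 2)))"
    proof -
      have "C1 / \<tau> ^ DIM('a) * (C2 * \<tau> powr (?d - e))\<^sup>2 = C1 * C2\<^sup>2 * (\<tau> powr (- ?d) * (\<tau> powr (?d - e) * \<tau> powr (?d - e)))"
        using \<tau> by (simp add: powr_minus powr_realpow power2_eq_square field_simps)
      also have "\<tau> powr (- ?d) * (\<tau> powr (?d - e) * \<tau> powr (?d - e)) = \<tau> powr (- (2 * (e - ?d / 2)))"
        unfolding powr_add[symmetric] by (simp add: algebra_simps)
      finally show ?thesis .
    qed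
    finally show "(\<integral>\<^sup>+z. ennreal (cmod (fourier_measure M (\<tau> *\<^sub>R z))) \<partial>difference_measure M)
      \<le> ennreal ((1 + C1 * C2\<^sup>2) * \<tau> powr (- (min s ?d - ?d / 2)))"
      unfolding e_def[symmetric] using \<tau> C1 C2
      by (intro fourier_average_le_of_square N Mf sets) auto
  qed (use C1 C2 in simp)
qed

text \<open>With \<open>e = min s (d / 2)\<close> the factor \<open>E\<close> is \<open>O(\<tau>^(d - 2 e))\<close>, so the square mean is
  \<open>O(\<tau>^(d / 2 - 2 e))\<close>, and its square root has the stated exponent.\<close>

lemma fourier_average_decay_fourth:
  fixes M :: "'a::euclidean_space measure" and s :: real
  assumes M: "prob_space M" and sets [measurable_cong]: "sets M = sets borel"
    and R: "AE x in M. norm x \<le> R"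
    and fin: "(\<integral>\<^sup>+v. ennreal ((cmod (fourier_measure M v)) ^ 4 * norm v powr (2 * s - real DIM('a))) \<partial>lborel) < \<infinity>"
  shows "\<exists>C\<ge>0. \<forall>\<tau>\<ge>1. (\<integral>\<^sup>+z. ennreal (cmod (fourier_measure M (\<tau> *\<^sub>R z))) \<partial>difference_measure M)
    \<le> ennreal (C * \<tau> powr (- (min s (real DIM('a) / 2) - real DIM('a) / 4)))"
proof -
  let ?d = "real DIM('a)"
  define e where "e = min s (?d / 2)"
  have e: "min (2 * s) ?d = 2 * e" by (auto simp: e_def min_def)
  interpret prob_space M by fact
  note Mf = finite_measure_axioms
  note N = prob_space_difference_measure[OF M sets]
  note [measurable] = measurable_fourier_measure[OF Mf sets]
  define E where "E a = (\<integral>\<^sup>+v. ennreal ((cmod (fourier_measure M v)) ^ 4 * gauss a v) \<partial>lborel)" for a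
  obtain C1 where C1: "C1 \<ge> 0" "\<And>\<tau>. \<tau> \<ge> 1 \<Longrightarrow> (\<integral>\<^sup>+z. ennreal ((cmod (fourier_measure M (\<tau> *\<^sub>R z)))\<^sup>2) \<partial>difference_measure M)
    \<le> ennreal (C1 * \<tau> powr (- ?d / 2)) * E (1 / (4 * \<tau>\<^sup>2))"
    using fourier_square_difference_le_fourth_energy[OF M sets R] unfolding E_def by blast
  obtain C2 where C2: "C2 \<ge> 0" "\<And>\<tau>. \<tau> \<ge> 1 \<Longrightarrow> E ((1 / 4) / \<tau>\<^sup>2) \<le> ennreal (C2 * \<tau> powr (?d - 2 * e))"
    using gauss_energy_le_of_power_energy[OF _ _ _ fin, of "1 / 4"] norm_fourier_measure_le_1[OF M sets]
    unfolding E_def e by (auto simp: power_le_one)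
  show ?thesis
  proof (intro exI[of _ "1 + C1 * C2"] conjI allI impI)
    fix \<tau> :: real assume \<tau>: "\<tau> \<ge> 1"
    note C1(2)[OF \<tau>]
    also have "ennreal (C1 * \<tau> powr (- ?d / 2)) * E (1 / (4 * \<tau>\<^sup>2)) \<le> ennreal (C1 * \<tau> powr (- ?d / 2)) * ennreal (C2 * \<tau> powr (?d - 2 * e))"
      using C2(2)[OF \<tau>] by (intro mult_left_mono) auto
    also have "\<dots> = ennreal (C1 * C2 * (\<tau> powr (- ?d / 2) * \<tau> powr (?d - 2 * e)))"
      using C1 C2 by (subst ennreal_mult[symmetric]) (auto simp: mult_ac)
    also have "\<tau> powr (- ?d / 2) * \<tau> powr (?d - 2 * e) = \<tau> powr (- (2 * (e - ?d / 4)))"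
      unfolding powr_add[symmetric] by (simp add: algebra_simps)
    finally show "(\<integral>\<^sup>+z. ennreal (cmod (fourier_measure M (\<tau> *\<^sub>R z))) \<partial>difference_measure M)
      \<le> ennreal ((1 + C1 * C2) * \<tau> powr (- (min s (?d / 2) - ?d / 4)))"
      unfolding e_def[symmetric] using \<tau> C1 C2
      by (intro fourier_average_le_of_square N Mf sets) auto
  qed (use C1 C2 in simp)
qed

section \<open>Small values and characteristic functions\<close>

text \<open>The indicator of \<open>[-r, r]\<close> is at most \<open>e^(1/2)\<close> times a Gaussian of width \<open>r\<close>, and that Gaussian is
  an average of characters \<open>cis (T / r * f)\<close> over a standard normal \<open>T\<close>.\<close>

lemma (in prob_space) prob_small_le_char:
  fixes f :: "'a \<Rightarrow> real"
  assumes [measurable]: "f \<in> borel_measurable M" and r: "r > 0"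
  shows "emeasure M {x\<in>space M. \<bar>f x\<bar> \<le> r} \<le> ennreal (exp (1 / 2)) *
    (\<integral>\<^sup>+T. ennreal (cmod (\<integral>x. cis (T / r * f x) \<partial>M)) \<partial>std_normal_distribution)"
proof -
  interpret T: real_distribution std_normal_distribution by (rule real_dist_normal_dist)
  interpret P: pair_prob_space std_normal_distribution M ..
  have cis_le: "complex_of_real (exp (- (f x / r)\<^sup>2 / 2)) = (\<integral>T. cis (T / r * f x) \<partial>std_normal_distribution)" for x
  proof -
    have "(\<integral>T. cis (T / r * f x) \<partial>std_normal_distribution) = char std_normal_distribution (f x / r)"
      unfolding char_def by (simp add: cis_conv_exp mult_ac)
    then show ?thesis by (simp add: char_std_normal_distribution)
  qed
  have int: "integrable (std_normal_distribution \<Otimes>\<^sub>M M) (\<lambda>(T, x). cis (T / r * f x))"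
    unfolding split_beta' by (rule integrable_cis) (auto intro: P.finite_measure_axioms)
  have bd: "integrable M (\<lambda>x. exp (- (f x / r)\<^sup>2 / 2))"
    by (rule integrable_const_bound[of _ 1]) auto
  have "emeasure M {x\<in>space M. \<bar>f x\<bar> \<le> r} = (\<integral>\<^sup>+x. indicator {x\<in>space M. \<bar>f x\<bar> \<le> r} x \<partial>M)"
    by simp
  also have "\<dots> \<le> (\<integral>\<^sup>+x. ennreal (exp (1 / 2)) * ennreal (exp (- (f x / r)\<^sup>2 / 2)) \<partial>M)"
  proof (intro nn_integral_mono)
    fix x
    show "indicator {x\<in>space M. \<bar>f x\<bar> \<le> r} x \<le> ennreal (exp (1 / 2)) * ennreal (exp (- (f x / r)\<^sup>2 / 2))"
    proof (cases "\<bar>f x\<bar> \<le> r")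
      case True
      then have "(f x / r)\<^sup>2 \<le> 1" using r by (simp add: abs_square_le_1)
      then have "1 \<le> exp (1 / 2) * exp (- (f x / r)\<^sup>2 / 2)" by (simp add: exp_add[symmetric])
      then have "ennreal 1 \<le> ennreal (exp (1 / 2) * exp (- (f x / r)\<^sup>2 / 2))" by (rule ennreal_leI)
      then have "1 \<le> ennreal (exp (1 / 2)) * ennreal (exp (- (f x / r)\<^sup>2 / 2))"
        by (simp only: ennreal_mult[OF exp_ge_zero exp_ge_zero] ennreal_1)
      then show ?thesis by (auto simp: indicator_def)
    qed simp
  qed
  also have "\<dots> = ennreal (exp (1 / 2)) * ennreal (\<integral>x. exp (- (f x / r)\<^sup>2 / 2) \<partial>M)"
    unfolding nn_integral_eq_integral[OF bd AE_I2[OF exp_ge_zero], symmetric]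
    by (rule nn_integral_cmult) measurable
  also have "(\<integral>x. exp (- (f x / r)\<^sup>2 / 2) \<partial>M) = cmod (\<integral>T. \<integral>x. cis (T / r * f x) \<partial>M \<partial>std_normal_distribution)"
  proof -
    have "complex_of_real (\<integral>x. exp (- (f x / r)\<^sup>2 / 2) \<partial>M) = (\<integral>x. \<integral>T. cis (T / r * f x) \<partial>std_normal_distribution \<partial>M)"
      unfolding cis_le[symmetric] by simp
    also have "\<dots> = (\<integral>T. \<integral>x. cis (T / r * f x) \<partial>M \<partial>std_normal_distribution)"
      by (rule P.Fubini_integral[OF int])
    finally have "(\<integral>T. \<integral>x. cis (T / r * f x) \<partial>M \<partial>std_normal_distribution) = complex_of_real (\<integral>x. exp (- (f x / r)\<^sup>2 / 2) \<partial>M)" ..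
    then show ?thesis by simp
  qed
  also have "ennreal \<dots> \<le> (\<integral>\<^sup>+T. ennreal (cmod (\<integral>x. cis (T / r * f x) \<partial>M)) \<partial>std_normal_distribution)"
    by (rule norm_integral_le_nn_integral)
  finally show ?thesis by (simp add: mult_left_mono)
qed

text \<open>The density is bounded and the power is integrable at the origin for \<open>t < 1\<close>; this is where the
  cap 1 on the dimension enters.\<close>

lemma negative_moment_std_normal:
  assumes t: "0 \<le> t" "t < 1"
  shows "(\<integral>\<^sup>+T. ennreal (\<bar>T\<bar> powr (- t)) \<partial>std_normal_distribution) < \<infinity>"
proof -
  interpret T: real_distribution std_normal_distribution by (rule real_dist_normal_dist)
  \<comment> \<open>The density is at most 1, and away from \<open>[-1, 1]\<close> so is the power.\<close>
  let ?g = "\<lambda>T::real. (if 0 \<le> T \<and> T \<le> 1 then T powr (- t) else 0)"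
  have "((\<lambda>T. T powr (- t)) has_integral (1 powr (- t + 1) / (- t + 1))) {0..1}"
    using t by (intro has_integral_powr_from_0) auto
  then have I: "(?g has_integral (1 powr (- t + 1) / (- t + 1))) UNIV"
    by (subst (asm) has_integral_restrict_UNIV[symmetric]) (simp add: if_distrib cong: if_cong)
  have g: "(\<integral>\<^sup>+T. ennreal (?g T) \<partial>lborel) = ennreal (1 powr (- t + 1) / (- t + 1))"
    by (rule nn_integral_has_integral_lborel[OF _ _ I]) (auto simp: t)
  have g': "(\<integral>\<^sup>+T. ennreal (?g (- T)) \<partial>lborel) = (\<integral>\<^sup>+T. ennreal (?g T) \<partial>lborel)"
    by (rule nn_integral_lborel_reflect[of "\<lambda>T. ennreal (?g T)" 0, unfolded diff_0]) measurable
  have le1: "std_normal_density T \<le> 1" for T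
  proof -
    have "1 / sqrt (2 * pi) \<le> 1" using pi_ge_two by (simp add: real_le_rsqrt)
    moreover have "exp (- T\<^sup>2 / 2) \<le> 1" by simp
    ultimately have "1 / sqrt (2 * pi) * exp (- T\<^sup>2 / 2) \<le> 1 * 1" by (intro mult_mono) auto
    then show ?thesis by (simp add: std_normal_density_def)
  qed
  have "(\<integral>\<^sup>+T. ennreal (\<bar>T\<bar> powr (- t)) \<partial>std_normal_distribution)
     = (\<integral>\<^sup>+T. ennreal (std_normal_density T) * ennreal (\<bar>T\<bar> powr (- t)) \<partial>lborel)"
    by (subst nn_integral_density) auto
  also have "\<dots> \<le> (\<integral>\<^sup>+T. ennreal (std_normal_density T) + (ennreal (?g T) + ennreal (?g (- T))) \<partial>lborel)"
  proof (intro nn_integral_mono)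
    fix T :: real
    have "std_normal_density T * \<bar>T\<bar> powr (- t) \<le> std_normal_density T + (?g T + ?g (- T))"
    proof (cases "\<bar>T\<bar> \<le> 1")
      case True
      have "std_normal_density T * \<bar>T\<bar> powr (- t) \<le> 1 * \<bar>T\<bar> powr (- t)"
        by (intro mult_right_mono le1) auto
      also have "\<dots> \<le> ?g T + ?g (- T)" using True by (auto simp: abs_if)
      finally show ?thesis by (simp add: add_increasing)
    next
      case False
      then have "\<bar>T\<bar> powr (- t) \<le> \<bar>T\<bar> powr 0" using t by (intro powr_mono) auto
      then have "\<bar>T\<bar> powr (- t) \<le> 1" using False by (auto split: if_splits)
      then have "std_normal_density T * \<bar>T\<bar> powr (- t) \<le> std_normal_density T * 1"
        by (intro mult_left_mono) auto
      moreover have "0 \<le> ?g T + ?g (- T)" by simp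
      ultimately show ?thesis by linarith
    qed
    from ennreal_leI[OF this]
    show "ennreal (std_normal_density T) * ennreal (\<bar>T\<bar> powr (- t)) \<le> ennreal (std_normal_density T) + (ennreal (?g T) + ennreal (?g (- T)))"
      by (simp add: ennreal_mult[symmetric])
  qed
  also have "\<dots> = (\<integral>\<^sup>+T. ennreal (std_normal_density T) \<partial>lborel) + ((\<integral>\<^sup>+T. ennreal (?g T) \<partial>lborel) + (\<integral>\<^sup>+T. ennreal (?g (- T)) \<partial>lborel))"
    by (simp add: nn_integral_add)
  also have "\<dots> < \<infinity>"
    unfolding g g' by (subst nn_integral_eq_integral) (auto simp: ennreal_add_eq_top)
  finally show ?thesis .
qed

section \<open>Decay from a pointwise bound on the Fourier transform\<close>

lemma dyadic_bracket:
  fixes x :: real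
  assumes "0 < x" "x \<le> 1"
  obtains k where "(1 / 2) ^ Suc k < x" "x \<le> (1 / 2) ^ k"
proof -
  let ?P = "\<lambda>k. (1 / 2) ^ Suc k < x"
  obtain n where "(1 / 2) ^ n < x" using real_arch_pow_inv[of x "1 / 2"] assms by auto
  moreover have "(1 / 2 :: real) ^ Suc n \<le> (1 / 2) ^ n" by simp
  ultimately have "?P n" by linarith
  then have 1: "?P (LEAST k. ?P k)" by (rule LeastI)
  have "x \<le> (1 / 2) ^ (LEAST k. ?P k)"
  proof (cases "LEAST k. ?P k")
    case 0
    then show ?thesis using assms by simp
  next
    case (Suc j)
    then have "\<not> ?P j" using not_less_Least[of j ?P] by simp
    then show ?thesis unfolding Suc by simp
  qed
  with 1 that show ?thesis by blast
qed

lemma powr_half_power: "((1 / 2 :: real) ^ k) powr t = ((1 / 2) powr t) ^ k"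
  by (simp add: powr_realpow[symmetric] powr_powr mult.commute)

lemma suminf_geometric_ennreal_finite:
  fixes q :: real
  assumes "0 \<le> q" "q < 1" "c \<ge> 0"
  shows "(\<Sum>k. ennreal (c * q ^ k)) < \<infinity>"
proof -
  have "summable (\<lambda>k. c * q ^ k)" using assms by (intro summable_mult summable_geometric) auto
  then have "(\<Sum>k. ennreal (c * q ^ k)) = ennreal (\<Sum>k. c * q ^ k)"
    using assms by (intro suminf_ennreal2) auto
  then show ?thesis by simp
qed

lemma term_le_suminf: "f k \<le> suminf f" for f :: "nat \<Rightarrow> ennreal"
  using sum_le_suminf[of f "{k}"] by simp

text \<open>A dyadic decomposition leads to a geometric series, convergent for \<open>t < a\<close>. The origin needs
  separate treatment because \<open>0 powr (- t)\<close> is 0 rather than \<open>\<infinity>\<close>.\<close>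

lemma negative_moment_of_small_balls:
  fixes N :: "'a::euclidean_space measure"
  assumes N: "prob_space N" and sets [measurable_cong]: "sets N = sets borel"
    and ball: "\<And>r. r > 0 \<Longrightarrow> emeasure N {z. norm z \<le> r} \<le> ennreal (C * r powr a)"
    and t: "0 < t" "t < a" and C: "C \<ge> 0"
  shows "AE z in N. z \<noteq> 0" and "(\<integral>\<^sup>+z. ennreal (norm z powr (- t)) \<partial>N) < \<infinity>"
proof -
  interpret N: prob_space N by fact
  have le: "emeasure N {0} \<le> ennreal (C * ((1 / 2) powr a) ^ k)" for k
  proof -
    have "emeasure N {0} \<le> emeasure N {z. norm z \<le> (1 / 2) ^ k}" by (intro emeasure_mono) auto
    also have "\<dots> \<le> ennreal (C * ((1 / 2) powr a) ^ k)"
      using ball[of "(1 / 2) ^ k"] by (simp only: powr_half_power) simp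
    finally show ?thesis .
  qed
  have q: "(1 / 2) powr a < 1" using powr_less_mono2[of a "1 / 2" 1] t by simp
  have "(\<lambda>k. ennreal (C * ((1 / 2) powr a) ^ k)) \<longlonglongrightarrow> ennreal (C * 0)"
    using q by (intro tendsto_ennrealI tendsto_mult tendsto_const LIMSEQ_realpow_zero) auto
  then have "emeasure N {0} \<le> ennreal (C * 0)"
    by (rule LIMSEQ_le_const) (use le in auto)
  then have "emeasure N {0} = 0" by simp
  then show "AE z in N. z \<noteq> 0" by (intro AE_I[of _ _ "{0}"]) auto
  have key: "ennreal (norm z powr (- t)) \<le> 1 + (\<Sum>k. ennreal ((2 powr t) ^ Suc k) * indicator {z. norm z \<le> (1 / 2) ^ k} z)" (is "_ \<le> 1 + (\<Sum>k. ?h k z)")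
    for z :: 'a
  proof (cases "norm z \<le> 1 \<and> z \<noteq> 0")
    case True
    then obtain k where k: "(1 / 2) ^ Suc k < norm z" "norm z \<le> (1 / 2) ^ k"
      using dyadic_bracket[of "norm z"] by auto
    have "norm z powr (- t) \<le> ((1 / 2) ^ Suc k) powr (- t)"
      using k t by (intro powr_mono2') auto
    also have "\<dots> = (2 powr t) ^ Suc k"
      unfolding powr_half_power by (simp add: powr_minus_divide powr_divide)
    finally have "ennreal (norm z powr (- t)) \<le> ennreal ((2 powr t) ^ Suc k)" by (rule ennreal_leI)
    also have "\<dots> = ?h k z" using k by simp
    also have "\<dots> \<le> (\<Sum>k. ?h k z)"
      by (rule term_le_suminf)
    finally show ?thesis by (simp add: add_increasing)
  next
    case False
    then have "norm z powr (- t) \<le> 1"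
      using powr_mono[of "- t" 0 "norm z"] t by (cases "z = 0") auto
    then have "ennreal (norm z powr (- t)) \<le> 1" by simp
    then show ?thesis by (simp add: add_increasing2)
  qed
  have "(\<integral>\<^sup>+z. ennreal (norm z powr (- t)) \<partial>N) \<le> (\<integral>\<^sup>+z. 1 + (\<Sum>k. ?h k z) \<partial>N)"
    by (intro nn_integral_mono key)
  also have "\<dots> = 1 + (\<Sum>k. \<integral>\<^sup>+z. ?h k z \<partial>N)"
    by (subst nn_integral_add) (auto simp: nn_integral_suminf N.emeasure_space_1)
  also have "(\<Sum>k. \<integral>\<^sup>+z. ?h k z \<partial>N) \<le> (\<Sum>k. ennreal (2 powr t * C * (2 powr (t - a)) ^ k))"
  proof (intro suminf_le allI)
    fix k
    have "(\<integral>\<^sup>+z. ?h k z \<partial>N) = ennreal ((2 powr t) ^ Suc k) * emeasure N {z. norm z \<le> (1 / 2) ^ k}"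
      by (subst nn_integral_cmult_indicator) auto
    also have "\<dots> \<le> ennreal ((2 powr t) ^ Suc k) * ennreal (C * ((1 / 2) ^ k) powr a)"
      by (intro mult_left_mono ball) auto
    also have "\<dots> = ennreal ((2 powr t) ^ Suc k * (C * ((1 / 2) ^ k) powr a))"
      using C by (simp add: ennreal_mult)
    also have "(2 powr t) ^ Suc k * (C * ((1 / 2) ^ k) powr a) = 2 powr t * C * (2 powr (t - a)) ^ k"
    proof -
      have "((1 / 2) ^ k) powr a = (2 powr (- a)) ^ k"
        unfolding powr_half_power by (simp add: powr_minus_divide powr_divide)
      moreover have "2 powr (t - a) = 2 powr t * (2 powr (- a) :: real)"
        by (simp add: powr_add[symmetric])
      ultimately show ?thesis by (simp add: power_mult_distrib mult_ac)
    qed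
    finally show "(\<integral>\<^sup>+z. ?h k z \<partial>N) \<le> ennreal (2 powr t * C * (2 powr (t - a)) ^ k)" .
  qed auto
  also have "1 + (\<Sum>k. ennreal (2 powr t * C * (2 powr (t - a)) ^ k)) < \<infinity>"
  proof -
    have "(\<Sum>k. ennreal (2 powr t * C * (2 powr (t - a)) ^ k)) < \<infinity>"
      using powr_less_mono[of "t - a" 0 2] t C by (intro suminf_geometric_ennreal_finite) auto
    then show ?thesis by (simp only: infinity_ennreal_def ennreal_add_less_top) simp
  qed
  finally show "(\<integral>\<^sup>+z. ennreal (norm z powr (- t)) \<partial>N) < \<infinity>"
    by (simp add: add_left_mono)
qed

text \<open>Near the origin the trivial bound \<open>|F| \<le> 1\<close> takes over, so a decay exponent may be lowered.\<close>

lemma fourier_square_le_of_decay: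
  fixes M :: "'a::euclidean_space measure"
  assumes M: "prob_space M" and sets: "sets M = sets borel"
    and J: "\<And>z. (cmod (fourier_measure M z))\<^sup>2 * rpow (norm z) s \<le> J"
    and b: "0 \<le> b" "b \<le> s" "z \<noteq> 0"
  shows "(cmod (fourier_measure M z))\<^sup>2 \<le> (1 + J) * norm z powr (- b)"
proof -
  let ?F = "(cmod (fourier_measure M z))\<^sup>2"
  have J0: "J \<ge> 0"
    using order_trans[OF _ J[of 0]] by (simp add: rpow_def)
  have F1: "?F \<le> 1" using norm_fourier_measure_le_1[OF M sets, of z] by (simp add: power_le_one)
  show ?thesis
  proof (cases "norm z \<le> 1")
    case True
    then have "1 \<le> norm z powr (- b)"
      using powr_mono2'[of "- b" "norm z" 1] b by simp
    then have "1 * 1 \<le> (1 + J) * norm z powr (- b)" using J0 by (intro mult_mono) auto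
    then show ?thesis using F1 by simp
  next
    case False
    then have n: "norm z > 1" by simp
    have "?F * norm z powr s \<le> J" using J[of z] b n by (cases "s = 0") (auto simp: rpow_def)
    then have "?F \<le> J * norm z powr (- s)"
      using n b by (simp add: powr_minus_divide pos_le_divide_eq)
    also have "\<dots> \<le> (1 + J) * norm z powr (- b)"
      using J0 n b by (intro mult_mono powr_mono) auto
    finally show ?thesis .
  qed
qed

text \<open>A ball lies in a slab, so it suffices to look at one coordinate of the difference, whose
  characteristic function is \<open>|F|^2\<close> along an axis. The restriction \<open>a < 1\<close> is the price for using one
  coordinate only, and it is affordable since only exponents below 1 matter for distance sets.\<close>

lemma difference_small_ball_of_decay:
  fixes M :: "'a::euclidean_space measure"
  assumes M: "prob_space M" and sets [measurable_cong]: "sets M = sets borel"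
    and J: "\<And>z. (cmod (fourier_measure M z))\<^sup>2 * rpow (norm z) s \<le> J"
    and a: "0 \<le> a" "a \<le> s" "a < 1"
  shows "\<exists>C\<ge>0. \<forall>r>0. emeasure (difference_measure M) {z. norm z \<le> r} \<le> ennreal (C * r powr a)"
proof -
  interpret prob_space M by fact
  note Mf = finite_measure_axioms
  let ?N = "difference_measure M"
  interpret N: prob_space ?N by (rule prob_space_difference_measure[OF M sets])
  interpret T: real_distribution std_normal_distribution by (rule real_dist_normal_dist)
  have J0: "J \<ge> 0"
    using order_trans[OF _ J[of 0]] by (simp add: rpow_def)
  define m where "m = enn2real (\<integral>\<^sup>+T. ennreal (\<bar>T\<bar> powr (- a)) \<partial>std_normal_distribution)"
  have m: "(\<integral>\<^sup>+T. ennreal (\<bar>T\<bar> powr (- a)) \<partial>std_normal_distribution) = ennreal m" "m \<ge> 0"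
    using negative_moment_std_normal[of a] a by (simp_all add: m_def)
  have T0: "AE T in std_normal_distribution. T \<noteq> 0"
    using AE_lborel_singleton[of "0::real"] by (subst AE_density) (auto elim: eventually_mono)
  show ?thesis
  proof (intro exI[of _ "exp (1 / 2) * ((1 + J) * (2 * pi) powr a * m)"] conjI allI impI)
    fix r :: real assume r: "r > 0"
    obtain b :: 'a where b: "b \<in> Basis" using nonempty_Basis by blast
    have "emeasure ?N {z. norm z \<le> r} \<le> emeasure ?N {z\<in>space ?N. \<bar>z \<bullet> b\<bar> \<le> r}"
      by (intro emeasure_mono) (auto intro: order_trans[OF Basis_le_norm[OF b]])
    also have "\<dots> \<le> ennreal (exp (1 / 2)) * (\<integral>\<^sup>+T. ennreal (cmod (\<integral>z. cis (T / r * (z \<bullet> b)) \<partial>?N)) \<partial>std_normal_distribution)"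
      by (rule N.prob_small_le_char) (use r in auto)
    also have "(\<integral>\<^sup>+T. ennreal (cmod (\<integral>z. cis (T / r * (z \<bullet> b)) \<partial>?N)) \<partial>std_normal_distribution)
      \<le> (\<integral>\<^sup>+T. ennreal ((1 + J) * (2 * pi * r) powr a) * ennreal (\<bar>T\<bar> powr (- a)) \<partial>std_normal_distribution)"
    proof (rule nn_integral_mono_AE, use T0 in eventually_elim)
      fix T :: real assume T: "T \<noteq> 0"
      define w where "w = (- (T / (2 * pi * r))) *\<^sub>R b"
      have w: "w \<noteq> 0" "norm w = \<bar>T\<bar> / (2 * pi * r)"
        using T r b by (auto simp: w_def)
      have "(\<integral>z. cis (T / r * (z \<bullet> b)) \<partial>?N) = fourier_measure ?N w"
        unfolding fourier_measure_def
        by (intro Bochner_Integration.integral_cong refl arg_cong[of _ _ cis])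
          (use r in \<open>simp add: w_def inner_commute field_simps\<close>)
      then have "cmod (\<integral>z. cis (T / r * (z \<bullet> b)) \<partial>?N) = (cmod (fourier_measure M w))\<^sup>2"
        unfolding fourier_difference_measure[OF Mf sets] by (simp add: norm_power)
      also have "\<dots> \<le> (1 + J) * norm w powr (- a)"
        by (rule fourier_square_le_of_decay[OF M sets J]) (use a w in auto)
      also have "norm w powr (- a) = (2 * pi * r) powr a * \<bar>T\<bar> powr (- a)"
        using r T by (simp add: w powr_divide powr_minus field_simps)
      finally show "ennreal (cmod (\<integral>z. cis (T / r * (z \<bullet> b)) \<partial>?N)) \<le> ennreal ((1 + J) * (2 * pi * r) powr a) * ennreal (\<bar>T\<bar> powr (- a))"
        using J0 by (simp add: ennreal_mult[symmetric] ennreal_leI mult.assoc)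
    qed
    also have "\<dots> = ennreal ((1 + J) * (2 * pi * r) powr a) * ennreal m"
      unfolding m(1)[symmetric] by (rule nn_integral_cmult) measurable
    also have "ennreal (exp (1 / 2)) * (ennreal ((1 + J) * (2 * pi * r) powr a) * ennreal m)
       = ennreal (exp (1 / 2) * ((1 + J) * (2 * pi) powr a * m) * r powr a)"
      using J0 m r by (simp add: ennreal_mult[symmetric] powr_mult mult_ac)
    finally show "emeasure ?N {z. norm z \<le> r} \<le> ennreal (exp (1 / 2) * ((1 + J) * (2 * pi) powr a * m) * r powr a)"
      by (simp add: mult_left_mono)
  qed (use J0 m in simp)
qed

text \<open>At \<open>\<tau> z\<close> the pointwise bound separates into \<open>\<tau>^(-t)\<close> and \<open>|z|^(-t)\<close>, and the latter has a finite
  integral since differences rarely fall into small balls.\<close>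

lemma fourier_average_decay_pointwise:
  fixes M :: "'a::euclidean_space measure"
  assumes M: "prob_space M" and sets [measurable_cong]: "sets M = sets borel"
    and J: "\<And>z. (cmod (fourier_measure M z))\<^sup>2 * rpow (norm z) s \<le> J"
    and t: "0 < t" "t < 1" "2 * t \<le> s"
  shows "\<exists>C\<ge>0. \<forall>\<tau>\<ge>1. (\<integral>\<^sup>+z. ennreal (cmod (fourier_measure M (\<tau> *\<^sub>R z))) \<partial>difference_measure M)
    \<le> ennreal (C * \<tau> powr (- t))"
proof -
  let ?N = "difference_measure M"
  note N = prob_space_difference_measure[OF M sets]
  \<comment> \<open>Any exponent strictly between \<open>t\<close> and \<open>min 1 s\<close> serves.\<close>
  define a where "a = (t + min 1 s) / 2"
  have a: "t < a" "a \<le> s" "a < 1" using t by (auto simp: a_def)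
  have J0: "J \<ge> 0"
    using order_trans[OF _ J[of 0]] by (simp add: rpow_def)
  obtain C where C: "C \<ge> 0" "\<And>r. r > 0 \<Longrightarrow> emeasure ?N {z. norm z \<le> r} \<le> ennreal (C * r powr a)"
    using difference_small_ball_of_decay[OF M sets J, of a] a t by auto
  have nz: "AE z in ?N. z \<noteq> 0" and fin: "(\<integral>\<^sup>+z. ennreal (norm z powr (- t)) \<partial>?N) < \<infinity>"
    using negative_moment_of_small_balls[OF N _ C(2) t(1) a(1) C(1)] by simp_all
  define m where "m = enn2real (\<integral>\<^sup>+z. ennreal (norm z powr (- t)) \<partial>?N)"
  have m: "(\<integral>\<^sup>+z. ennreal (norm z powr (- t)) \<partial>?N) = ennreal m" "m \<ge> 0"
    using fin by (simp_all add: m_def)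
  show ?thesis
  proof (intro exI[of _ "sqrt (1 + J) * m"] conjI allI impI)
    fix \<tau> :: real assume \<tau>: "\<tau> \<ge> 1"
    have "(\<integral>\<^sup>+z. ennreal (cmod (fourier_measure M (\<tau> *\<^sub>R z))) \<partial>?N)
      \<le> (\<integral>\<^sup>+z. ennreal (sqrt (1 + J) * \<tau> powr (- t)) * ennreal (norm z powr (- t)) \<partial>?N)"
    proof (rule nn_integral_mono_AE, use nz in eventually_elim)
      fix z :: 'a assume z: "z \<noteq> 0"
      have "(cmod (fourier_measure M (\<tau> *\<^sub>R z)))\<^sup>2 \<le> (1 + J) * norm (\<tau> *\<^sub>R z) powr (- (2 * t))"
        by (rule fourier_square_le_of_decay[OF M sets J]) (use t z \<tau> in auto)
      also have "\<dots> = (sqrt (1 + J) * (\<tau> powr (- t) * norm z powr (- t)))\<^sup>2"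
      proof -
        have "(x powr (- t))\<^sup>2 = x powr (- (2 * t))" for x :: real
          by (simp add: power2_eq_square powr_add[symmetric])
        then show ?thesis using J0 \<tau> by (simp add: power_mult_distrib powr_mult)
      qed
      finally have "cmod (fourier_measure M (\<tau> *\<^sub>R z)) \<le> sqrt (1 + J) * (\<tau> powr (- t) * norm z powr (- t))"
        by (rule power2_le_imp_le) (use J0 in auto)
      then show "ennreal (cmod (fourier_measure M (\<tau> *\<^sub>R z))) \<le> ennreal (sqrt (1 + J) * \<tau> powr (- t)) * ennreal (norm z powr (- t))"
        using J0 by (simp add: ennreal_mult[symmetric] ennreal_leI mult.assoc)
    qed
    also have "\<dots> = ennreal (sqrt (1 + J) * \<tau> powr (- t)) * ennreal m"
      unfolding m(1)[symmetric] by (rule nn_integral_cmult) measurable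
    also have "\<dots> = ennreal (sqrt (1 + J) * m * \<tau> powr (- t))"
      using J0 m by (simp add: ennreal_mult[symmetric] mult_ac)
    finally show "(\<integral>\<^sup>+z. ennreal (cmod (fourier_measure M (\<tau> *\<^sub>R z))) \<partial>?N) \<le> ennreal (sqrt (1 + J) * m * \<tau> powr (- t))" .
  qed (use J0 m in simp)
qed

section \<open>Coincidences between distances from a random pin\<close>

lemma measurable_emeasure_sublevel:
  fixes f :: "'b \<times> 'a \<Rightarrow> real"
  assumes "sigma_finite_measure M" and f [measurable]: "f \<in> borel_measurable (N \<Otimes>\<^sub>M M)" and space: "space M = UNIV"
  shows "(\<lambda>p. emeasure M {y. f (p, y) \<le> c}) \<in> borel_measurable N"
proof -
  interpret sigma_finite_measure M by fact
  have "(\<lambda>p. emeasure M (Pair p -` {q \<in> space (N \<Otimes>\<^sub>M M). f q \<le> c})) \<in> borel_measurable N"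
    by (rule measurable_emeasure_Pair) measurable
  moreover have "Pair p -` {q \<in> space (N \<Otimes>\<^sub>M M). f q \<le> c} = {y. f (p, y) \<le> c}" if "p \<in> space N" for p
    using that by (auto simp: space_pair_measure space)
  ultimately show ?thesis
    by (subst measurable_cong[where g = "\<lambda>p. emeasure M (Pair p -` {q \<in> space (N \<Otimes>\<^sub>M M). f q \<le> c})"]) auto
qed

text \<open>Integrating over the pin first is what makes the phase linear: for fixed \<open>y\<close>, \<open>y'\<close> the
  difference of squared distances is affine in \<open>x\<close> with gradient \<open>-2 (y - y')\<close>.\<close>

lemma distance_small_scale_average:
  fixes M :: "'a::euclidean_space measure"
  assumes M: "prob_space M" and sets [measurable_cong]: "sets M = sets borel"
    and C: "C \<ge> 0" "\<And>\<tau>. \<tau> \<ge> 1 \<Longrightarrow> (\<integral>\<^sup>+z. ennreal (cmod (fourier_measure M (\<tau> *\<^sub>R z))) \<partial>difference_measure M)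
      \<le> ennreal (C * \<tau> powr (- t))"
    and t: "0 < t" "t < 1"
  shows "\<exists>C'\<ge>0. \<forall>r>0. (\<integral>\<^sup>+x. \<integral>\<^sup>+y. emeasure M {y'. \<bar>(dist x y)\<^sup>2 - (dist x y')\<^sup>2\<bar> \<le> r} \<partial>M \<partial>M)
            \<le> ennreal (C' * r powr t)"
proof -
  interpret prob_space M by fact
  note Mf = finite_measure_axioms
  have space: "space M = UNIV" using sets_eq_imp_space_eq[OF sets] by simp
  let ?N = "difference_measure M"
  interpret N: prob_space ?N by (rule prob_space_difference_measure[OF M sets])
  interpret T: real_distribution std_normal_distribution by (rule real_dist_normal_dist)
  interpret P: pair_prob_space M M ..
  interpret Q: pair_prob_space M std_normal_distribution ..
  note [measurable] = measurable_fourier_measure[OF Mf sets]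
  define m where "m = enn2real (\<integral>\<^sup>+T. ennreal (\<bar>T\<bar> powr (- t)) \<partial>std_normal_distribution)"
  have m: "(\<integral>\<^sup>+T. ennreal (\<bar>T\<bar> powr (- t)) \<partial>std_normal_distribution) = ennreal m" "m \<ge> 0"
    using negative_moment_std_normal[of t] t by (simp_all add: m_def)
  have T0: "AE T in std_normal_distribution. T \<noteq> 0"
    using AE_lborel_singleton[of "0::real"] by (subst AE_density) (auto elim: eventually_mono)
  define \<Psi> where "\<Psi> \<tau> = (\<integral>\<^sup>+z. ennreal (cmod (fourier_measure M (\<tau> *\<^sub>R z))) \<partial>?N)" for \<tau>
  \<comment> \<open>The assumed decay extends to all nonzero \<open>\<tau>\<close>: by symmetry to negative ones, and trivially to \<open>|\<tau>| < 1\<close>.\<close>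
  have \<Psi>: "\<Psi> \<tau> \<le> ennreal ((1 + C) * \<bar>\<tau>\<bar> powr (- t))" if "\<tau> \<noteq> 0" for \<tau>
  proof (cases "\<bar>\<tau>\<bar> \<ge> 1")
    case True
    have "\<Psi> \<tau> = \<Psi> \<bar>\<tau>\<bar>"
      unfolding \<Psi>_def by (intro nn_integral_cong) (simp add: abs_if fourier_measure_minus)
    also have "\<dots> \<le> ennreal (C * \<bar>\<tau>\<bar> powr (- t))" unfolding \<Psi>_def by (rule C(2)[OF True])
    also have "\<dots> \<le> ennreal ((1 + C) * \<bar>\<tau>\<bar> powr (- t))" by (intro ennreal_leI mult_right_mono) auto
    finally show ?thesis .
  next
    case False
    have "\<Psi> \<tau> \<le> (\<integral>\<^sup>+z. 1 \<partial>?N)"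
      unfolding \<Psi>_def using norm_fourier_measure_le_1[OF M sets] by (intro nn_integral_mono) simp
    also have "\<dots> = ennreal (1 * 1)" using N.emeasure_space_1 by simp
    also have "\<dots> \<le> ennreal ((1 + C) * \<bar>\<tau>\<bar> powr (- t))"
      using False that C t powr_mono2'[of "- t" "\<bar>\<tau>\<bar>" 1] by (intro ennreal_leI mult_mono) auto
    finally show ?thesis .
  qed
  show ?thesis
  proof (intro exI[of _ "exp (1 / 2) * ((1 + C) * pi powr t * m)"] conjI allI impI)
    fix r :: real assume r: "r > 0"
    define I :: "'a \<times> 'a \<times> 'a \<Rightarrow> ennreal" where
      "I p = indicator {p. \<bar>(dist (fst p) (fst (snd p)))\<^sup>2 - (dist (fst p) (snd (snd p)))\<^sup>2\<bar> \<le> r} p" for p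
    have [measurable]: "I \<in> borel_measurable (M \<Otimes>\<^sub>M (M \<Otimes>\<^sub>M M))"
    proof -
      have "{p \<in> space (M \<Otimes>\<^sub>M (M \<Otimes>\<^sub>M M)). \<bar>(dist (fst p) (fst (snd p)))\<^sup>2 - (dist (fst p) (snd (snd p)))\<^sup>2\<bar> \<le> r}
          \<in> sets (M \<Otimes>\<^sub>M (M \<Otimes>\<^sub>M M))" by measurable
      then show ?thesis
        unfolding I_def[abs_def] by (simp add: space_pair_measure space borel_measurable_indicator)
    qed
    have small: "(\<integral>\<^sup>+x. I (x, y, y') \<partial>M) \<le> ennreal (exp (1 / 2)) *
        (\<integral>\<^sup>+T. ennreal (cmod (fourier_measure M ((T / (pi * r)) *\<^sub>R (y - y')))) \<partial>std_normal_distribution)" for y y' :: 'a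
    proof -
      define f where "f x = (dist x y)\<^sup>2 - (dist x y')\<^sup>2" for x
      have [measurable]: "f \<in> borel_measurable borel" unfolding f_def[abs_def] by measurable
      have f: "f x = ((norm y)\<^sup>2 - (norm y')\<^sup>2) - 2 * ((y - y') \<bullet> x)" for x
        by (simp add: f_def dist_norm power2_norm_eq_inner inner_simps inner_commute)
      have eq: "cmod (\<integral>x. cis (T / r * f x) \<partial>M) = cmod (fourier_measure M ((T / (pi * r)) *\<^sub>R (y - y')))" for T
      proof -
        have "(\<integral>x. cis (T / r * f x) \<partial>M) = (\<integral>x. cis (T / r * ((norm y)\<^sup>2 - (norm y')\<^sup>2)) * cis (- (2 * pi * (((T / (pi * r)) *\<^sub>R (y - y')) \<bullet> x))) \<partial>M)"
          using r unfolding f inner_scaleR_left cis_mult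
          by (intro Bochner_Integration.integral_cong refl arg_cong[of _ _ cis])
            (simp add: right_diff_distrib)
        also have "\<dots> = cis (T / r * ((norm y)\<^sup>2 - (norm y')\<^sup>2)) * fourier_measure M ((T / (pi * r)) *\<^sub>R (y - y'))"
          unfolding fourier_measure_def by (rule integral_mult_right_zero)
        finally show ?thesis by (simp add: norm_mult)
      qed
      have "(\<integral>\<^sup>+x. I (x, y, y') \<partial>M) = (\<integral>\<^sup>+x. indicator {x\<in>space M. \<bar>f x\<bar> \<le> r} x \<partial>M)"
        by (intro nn_integral_cong) (simp add: I_def f_def indicator_def space)
      also have "\<dots> = emeasure M {x\<in>space M. \<bar>f x\<bar> \<le> r}" by simp
      also have "\<dots> \<le> ennreal (exp (1 / 2)) * (\<integral>\<^sup>+T. ennreal (cmod (\<integral>x. cis (T / r * f x) \<partial>M)) \<partial>std_normal_distribution)"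
        by (rule prob_small_le_char) (use r in auto)
      finally show ?thesis unfolding eq .
    qed
    have "(\<integral>\<^sup>+x. \<integral>\<^sup>+y. emeasure M {y'. \<bar>(dist x y)\<^sup>2 - (dist x y')\<^sup>2\<bar> \<le> r} \<partial>M \<partial>M)
       = (\<integral>\<^sup>+x. \<integral>\<^sup>+y. \<integral>\<^sup>+y'. I (x, y, y') \<partial>M \<partial>M \<partial>M)"
    proof (intro nn_integral_cong)
      fix x y :: 'a
      have "(\<integral>\<^sup>+y'. I (x, y, y') \<partial>M) = (\<integral>\<^sup>+y'. indicator {y'. \<bar>(dist x y)\<^sup>2 - (dist x y')\<^sup>2\<bar> \<le> r} y' \<partial>M)"
        by (intro nn_integral_cong) (simp add: I_def indicator_def)
      then show "emeasure M {y'. \<bar>(dist x y)\<^sup>2 - (dist x y')\<^sup>2\<bar> \<le> r} = (\<integral>\<^sup>+y'. I (x, y, y') \<partial>M)"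
        by simp
    qed
    also have "\<dots> = (\<integral>\<^sup>+y. \<integral>\<^sup>+x. \<integral>\<^sup>+y'. I (x, y, y') \<partial>M \<partial>M \<partial>M)"
      by (rule P.Fubini'[symmetric]) measurable
    also have "\<dots> = (\<integral>\<^sup>+y. \<integral>\<^sup>+y'. \<integral>\<^sup>+x. I (x, y, y') \<partial>M \<partial>M \<partial>M)"
      by (intro nn_integral_cong P.Fubini'[symmetric]) measurable
    also have "\<dots> \<le> (\<integral>\<^sup>+y. \<integral>\<^sup>+y'. ennreal (exp (1 / 2)) *
        (\<integral>\<^sup>+T. ennreal (cmod (fourier_measure M ((T / (pi * r)) *\<^sub>R (y - y')))) \<partial>std_normal_distribution) \<partial>M \<partial>M)"
      by (intro nn_integral_mono small)
    also have "\<dots> = (\<integral>\<^sup>+z. ennreal (exp (1 / 2)) *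
        (\<integral>\<^sup>+T. ennreal (cmod (fourier_measure M ((T / (pi * r)) *\<^sub>R z))) \<partial>std_normal_distribution) \<partial>?N)"
      by (rule nn_integral_difference_measure[symmetric, OF Mf sets]) measurable
    also have "\<dots> = ennreal (exp (1 / 2)) * (\<integral>\<^sup>+z. \<integral>\<^sup>+T. ennreal (cmod (fourier_measure M ((T / (pi * r)) *\<^sub>R z))) \<partial>std_normal_distribution \<partial>?N)"
      by (rule nn_integral_cmult) measurable
    also have "(\<integral>\<^sup>+z. \<integral>\<^sup>+T. ennreal (cmod (fourier_measure M ((T / (pi * r)) *\<^sub>R z))) \<partial>std_normal_distribution \<partial>?N)
       = (\<integral>\<^sup>+T. \<Psi> (T / (pi * r)) \<partial>std_normal_distribution)"
    proof -
      interpret R: pair_sigma_finite std_normal_distribution ?N ..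
      show ?thesis unfolding \<Psi>_def by (rule R.Fubini') measurable
    qed
    also have "\<dots> \<le> (\<integral>\<^sup>+T. ennreal ((1 + C) * (pi * r) powr t) * ennreal (\<bar>T\<bar> powr (- t)) \<partial>std_normal_distribution)"
    proof (rule nn_integral_mono_AE, use T0 in eventually_elim)
      fix T :: real assume T: "T \<noteq> 0"
      have "\<Psi> (T / (pi * r)) \<le> ennreal ((1 + C) * \<bar>T / (pi * r)\<bar> powr (- t))"
        by (rule \<Psi>) (use T r in simp)
      also have "\<bar>T / (pi * r)\<bar> powr (- t) = (pi * r) powr t * \<bar>T\<bar> powr (- t)"
        using r T by (simp add: abs_mult powr_divide powr_minus field_simps)
      finally show "\<Psi> (T / (pi * r)) \<le> ennreal ((1 + C) * (pi * r) powr t) * ennreal (\<bar>T\<bar> powr (- t))"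
        using C by (simp add: ennreal_mult[symmetric] mult.assoc)
    qed
    also have "\<dots> = ennreal ((1 + C) * (pi * r) powr t) * ennreal m"
      unfolding m(1)[symmetric] by (rule nn_integral_cmult) measurable
    also have "ennreal (exp (1 / 2)) * (ennreal ((1 + C) * (pi * r) powr t) * ennreal m)
       = ennreal (exp (1 / 2) * ((1 + C) * pi powr t * m) * r powr t)"
      using C m r by (simp add: ennreal_mult[symmetric] powr_mult mult_ac)
    finally show "(\<integral>\<^sup>+x. \<integral>\<^sup>+y. emeasure M {y'. \<bar>(dist x y)\<^sup>2 - (dist x y')\<^sup>2\<bar> \<le> r} \<partial>M \<partial>M)
      \<le> ennreal (exp (1 / 2) * ((1 + C) * pi powr t * m) * r powr t)"
      by (simp add: mult_left_mono)
  qed (use C m in simp)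
qed

text \<open>Weighting the scale \<open>2^(-k)\<close> by \<open>2^(s k)\<close> with \<open>s < t\<close> leaves a convergent geometric series, so for almost
  all \<open>x\<close> and \<open>y\<close> the weighted sum over all scales is finite, and it bounds each of its terms. On the
  bounded support, points with close distances from \<open>x\<close> also have close squared distances.\<close>

lemma AE_distance_local_dimension:
  fixes M :: "'a::euclidean_space measure"
  assumes M: "prob_space M" and sets [measurable_cong]: "sets M = sets borel"
    and R: "AE x in M. norm x \<le> R"
    and C: "C \<ge> 0" "\<And>r. r > 0 \<Longrightarrow> (\<integral>\<^sup>+x. \<integral>\<^sup>+y. emeasure M {y'. \<bar>(dist x y)\<^sup>2 - (dist x y')\<^sup>2\<bar> \<le> r} \<partial>M \<partial>M)
            \<le> ennreal (C * r powr t)"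
    and s: "0 < s" "s < t"
  shows "AE x in M. AE y in M. \<exists>K\<ge>0. \<forall>k. emeasure M {y'. \<bar>dist x y' - dist x y\<bar> \<le> (1 / 2) ^ k} \<le> ennreal (K * ((1 / 2) ^ k) powr s)"
proof -
  interpret prob_space M by fact
  interpret P: pair_prob_space M M ..
  define L where "L = 4 * \<bar>R\<bar> + 1"
  have L: "L > 0" by (simp add: L_def)
  let ?E2 = "\<lambda>r x y. emeasure M {y'. \<bar>(dist x y)\<^sup>2 - (dist x y')\<^sup>2\<bar> \<le> r}"
  have space: "space M = UNIV" using sets_eq_imp_space_eq[OF sets] by simp
  define E where "E k p = emeasure M {y'. \<bar>dist (fst p) y' - dist (fst p) (snd p)\<bar> \<le> (1 / 2) ^ k}" for k and p :: "'a \<times> 'a"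
  have [measurable]: "E k \<in> borel_measurable (M \<Otimes>\<^sub>M M)" for k
  proof -
    have "(\<lambda>p. emeasure M {y'. (\<lambda>q. \<bar>dist (fst (fst q)) (snd q) - dist (fst (fst q)) (snd (fst q))\<bar>) (p, y') \<le> (1 / 2) ^ k}) \<in> borel_measurable (M \<Otimes>\<^sub>M M)"
      by (rule measurable_emeasure_sublevel[OF sigma_finite_measure_axioms _ space]) measurable
    then show ?thesis by (simp add: E_def[abs_def])
  qed
  have le: "(\<integral>\<^sup>+x. \<integral>\<^sup>+y. E k (x, y) \<partial>M \<partial>M) \<le> ennreal (C * (L * (1 / 2) ^ k) powr t)" for k
  proof -
    have "(\<integral>\<^sup>+x. \<integral>\<^sup>+y. E k (x, y) \<partial>M \<partial>M) \<le> (\<integral>\<^sup>+x. \<integral>\<^sup>+y. ?E2 (L * (1 / 2) ^ k) x y \<partial>M \<partial>M)"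
    proof (rule nn_integral_mono_AE, use R in eventually_elim)
      fix x :: 'a assume x: "norm x \<le> R"
      show "(\<integral>\<^sup>+y. E k (x, y) \<partial>M) \<le> (\<integral>\<^sup>+y. ?E2 (L * (1 / 2) ^ k) x y \<partial>M)"
      proof (rule nn_integral_mono_AE, use R in eventually_elim)
        fix y :: 'a assume y: "norm y \<le> R"
        show "E k (x, y) \<le> ?E2 (L * (1 / 2) ^ k) x y"
          unfolding E_def fst_conv snd_conv
        proof (rule emeasure_mono_AE)
          show "AE y' in M. y' \<in> {y'. \<bar>dist x y' - dist x y\<bar> \<le> (1 / 2) ^ k} \<longrightarrow> y' \<in> {y'. \<bar>(dist x y)\<^sup>2 - (dist x y')\<^sup>2\<bar> \<le> L * (1 / 2) ^ k}"
            using R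
          proof eventually_elim
            case (elim y')
            have d: "dist x y \<le> 2 * \<bar>R\<bar>" "dist x y' \<le> 2 * \<bar>R\<bar>"
              using norm_triangle_ineq4[of x y] norm_triangle_ineq4[of x y'] x y elim by (auto simp: dist_norm)
            show ?case
            proof (clarsimp)
              assume a: "\<bar>dist x y' - dist x y\<bar> \<le> (1 / 2) ^ k"
              have "\<bar>(dist x y)\<^sup>2 - (dist x y')\<^sup>2\<bar> = (dist x y + dist x y') * \<bar>dist x y' - dist x y\<bar>"
              proof -
                have "(dist x y)\<^sup>2 - (dist x y')\<^sup>2 = (dist x y + dist x y') * (dist x y - dist x y')"
                  by (simp add: power2_eq_square algebra_simps)
                then show ?thesis by (simp add: abs_mult abs_minus_commute[of "dist x y"])
              qed
              also have "\<dots> \<le> L * (1 / 2) ^ k"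
                using d by (intro mult_mono a) (auto simp: L_def)
              finally show "\<bar>(dist x y)\<^sup>2 - (dist x y')\<^sup>2\<bar> \<le> L * (1 / 2) ^ k" .
            qed
          qed
        qed measurable
      qed
    qed
    also have "\<dots> \<le> ennreal (C * (L * (1 / 2) ^ k) powr t)"
      using L by (intro C(2)) auto
    finally show ?thesis .
  qed
  define w where "w k = (2 powr s) ^ k" for k
  have "(\<integral>\<^sup>+x. \<integral>\<^sup>+y. (\<Sum>k. ennreal (w k) * E k (x, y)) \<partial>M \<partial>M) = (\<integral>\<^sup>+x. (\<Sum>k. \<integral>\<^sup>+y. ennreal (w k) * E k (x, y) \<partial>M) \<partial>M)"
    by (intro nn_integral_cong nn_integral_suminf) measurable
  also have "\<dots> = (\<Sum>k. \<integral>\<^sup>+x. \<integral>\<^sup>+y. ennreal (w k) * E k (x, y) \<partial>M \<partial>M)"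
    by (rule nn_integral_suminf) measurable
  also have "\<dots> \<le> (\<Sum>k. ennreal (C * L powr t * (2 powr (s - t)) ^ k))"
  proof (intro suminf_le allI)
    fix k
    have "(\<integral>\<^sup>+x. \<integral>\<^sup>+y. ennreal (w k) * E k (x, y) \<partial>M \<partial>M) = ennreal (w k) * (\<integral>\<^sup>+x. \<integral>\<^sup>+y. E k (x, y) \<partial>M \<partial>M)"
    proof -
      have "(\<integral>\<^sup>+x. \<integral>\<^sup>+y. ennreal (w k) * E k (x, y) \<partial>M \<partial>M) = (\<integral>\<^sup>+x. ennreal (w k) * (\<integral>\<^sup>+y. E k (x, y) \<partial>M) \<partial>M)"
        by (intro nn_integral_cong nn_integral_cmult) measurable
      then show ?thesis by (simp add: nn_integral_cmult)
    qed
    also have "\<dots> \<le> ennreal (w k) * ennreal (C * (L * (1 / 2) ^ k) powr t)"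
      by (intro mult_left_mono le) auto
    also have "\<dots> = ennreal (w k * (C * (L * (1 / 2) ^ k) powr t))"
      using C by (simp add: w_def ennreal_mult)
    also have "(L * (1 / 2) ^ k) powr t = L powr t * (2 powr (- t)) ^ k"
      using L by (simp only: powr_mult powr_half_power) (simp add: powr_minus_divide powr_divide)
    also have "w k * (C * (L powr t * (2 powr (- t)) ^ k)) = C * L powr t * (2 powr (s - t)) ^ k"
    proof -
      have "2 powr (s - t) = 2 powr s * (2 powr (- t) :: real)"
        by (simp add: powr_add[symmetric])
      then show ?thesis by (simp add: w_def power_mult_distrib mult_ac)
    qed
    finally show "(\<integral>\<^sup>+x. \<integral>\<^sup>+y. ennreal (w k) * E k (x, y) \<partial>M \<partial>M) \<le> ennreal (C * L powr t * (2 powr (s - t)) ^ k)" .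
  qed auto
  also have "\<dots> < \<infinity>"
    using powr_less_mono[of "s - t" 0 2] s C by (intro suminf_geometric_ennreal_finite) auto
  finally have fin: "(\<integral>\<^sup>+x. \<integral>\<^sup>+y. (\<Sum>k. ennreal (w k) * E k (x, y)) \<partial>M \<partial>M) \<noteq> \<infinity>" by simp
  have "AE x in M. (\<integral>\<^sup>+y. (\<Sum>k. ennreal (w k) * E k (x, y)) \<partial>M) \<noteq> \<infinity>"
    by (rule nn_integral_PInf_AE[OF _ fin]) measurable
  then show ?thesis
  proof eventually_elim
    case (elim x)
    have [measurable]: "(\<lambda>y. E k (x, y)) \<in> borel_measurable M" for k
      by (rule measurable_compose[of "Pair x" _ "M \<Otimes>\<^sub>M M"], rule measurable_Pair1') (auto simp: space)
    have "AE y in M. (\<Sum>k. ennreal (w k) * E k (x, y)) \<noteq> \<infinity>"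
      by (rule nn_integral_PInf_AE[OF _ elim]) measurable
    then show ?case
    proof eventually_elim
      case (elim y)
      define K where "K = enn2real (\<Sum>k. ennreal (w k) * E k (x, y))"
      have K: "(\<Sum>k. ennreal (w k) * E k (x, y)) = ennreal K" "K \<ge> 0"
        using elim by (simp_all add: K_def less_top)
      show ?case
      proof (intro exI[of _ K] conjI allI K)
        fix k
        have w: "w k > 0" by (simp add: w_def)
        have "E k (x, y) = ennreal (1 / w k) * (ennreal (w k) * E k (x, y))"
          using w by (simp add: mult.assoc[symmetric] ennreal_mult[symmetric])
        also have "\<dots> \<le> ennreal (1 / w k) * (\<Sum>k. ennreal (w k) * E k (x, y))"
          by (intro mult_left_mono term_le_suminf[of "\<lambda>k. ennreal (w k) * E k (x, y)"]) auto
        also have "\<dots> = ennreal (1 / w k * K)"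
          unfolding K(1) using K w by (subst ennreal_mult) auto
        also have "1 / w k * K = K * ((1 / 2) ^ k) powr s"
          unfolding powr_half_power by (simp add: w_def powr_divide power_divide)
        finally show "emeasure M {y'. \<bar>dist x y' - dist x y\<bar> \<le> (1 / 2) ^ k} \<le> ennreal (K * ((1 / 2) ^ k) powr s)"
          by (simp add: E_def)
      qed
    qed
  qed
qed

section \<open>The mass distribution principle\<close>

text \<open>Letting \<open>k\<close> tend to infinity covers \<open>d = 0\<close>, which is needed because covers may contain
  single points.\<close>

lemma emeasure_le_powr_of_dyadic:
  fixes g :: "real \<Rightarrow> ennreal"
  assumes mono: "\<And>r r'. r \<le> r' \<Longrightarrow> g r \<le> g r'"
    and g: "\<And>k. g ((1 / 2) ^ k) \<le> ennreal (K * ((1 / 2) ^ k) powr t)"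
    and K: "K \<ge> 0" and t: "t > 0" and d: "0 \<le> d" "d \<le> 1"
  shows "g d \<le> ennreal (K * 2 powr t * d powr t)"
proof (cases "d = 0")
  case True
  have "(1 / 2) powr t < 1" using powr_less_mono2[of t "1 / 2" 1] t by simp
  then have "(\<lambda>k. ennreal (K * ((1 / 2) powr t) ^ k)) \<longlonglongrightarrow> ennreal (K * 0)"
    by (intro tendsto_ennrealI tendsto_mult tendsto_const LIMSEQ_realpow_zero) auto
  moreover have "g d \<le> ennreal (K * ((1 / 2) powr t) ^ k)" for k
    using order_trans[OF mono g, of d k] True by (simp only: powr_half_power) simp
  ultimately have "g d \<le> ennreal (K * 0)" by (intro LIMSEQ_le_const) auto
  then show ?thesis by simp
next
  case False
  then obtain k where k: "(1 / 2) ^ Suc k < d" "d \<le> (1 / 2) ^ k"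
    using dyadic_bracket[of d] d by auto
  have "g d \<le> g ((1 / 2) ^ k)" by (rule mono) (rule k)
  also have "\<dots> \<le> ennreal (K * ((1 / 2) ^ k) powr t)" by (rule g)
  also have "\<dots> \<le> ennreal (K * (2 * d) powr t)"
    using k t K by (intro ennreal_leI mult_left_mono powr_mono2) auto
  also have "K * (2 * d) powr t = K * 2 powr t * d powr t" using d by (simp add: powr_mult)
  finally show ?thesis .
qed

text \<open>The constants \<open>K\<close> depend on \<open>y\<close>, so one restricts to a set of positive measure on which they are
  bounded by some \<open>n\<close>. Every set of a cover that meets the image of this set lies in an interval
  about one of its points, hence its preimage has mass at most a constant times its weight; covers
  of small total weight would then contradict positivity of the measure.\<close>

lemma hausdorff_dim_ge_of_local_dimension:
  fixes f :: "'a \<Rightarrow> real"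
  assumes M: "prob_space M" and f [measurable]: "f \<in> borel_measurable M" and space: "space M = UNIV"
    and S: "S \<in> sets M" "AE y in M. y \<in> S"
    and loc: "AE y in M. \<exists>K\<ge>0. \<forall>k. emeasure M {y'. \<bar>f y' - f y\<bar> \<le> (1 / 2) ^ k} \<le> ennreal (K * ((1 / 2) ^ k) powr t)"
    and t: "t > 0"
  shows "ereal t \<le> hausdorff_dim (f ` S)"
  unfolding hausdorff_dim_def
proof (rule Inf_greatest)
  interpret prob_space M by fact
  fix u assume "u \<in> {ereal s |s. 0 \<le> s \<and> hausdorff_measure s (f ` S) = 0}"
  then obtain s where s: "u = ereal s" "0 \<le> s" "hausdorff_measure s (f ` S) = 0" by auto
  have "t \<le> s"
  proof (rule ccontr)
    assume "\<not> t \<le> s"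
    then have st: "s < t" by simp
    let ?D = "\<lambda>y r. {y'. \<bar>f y' - f y\<bar> \<le> r}"
    have meas: "?D y r \<in> sets M" for y r
    proof -
      have "{y' \<in> space M. \<bar>f y' - f y\<bar> \<le> r} \<in> sets M" by measurable
      then show ?thesis by (simp add: space)
    qed
    define A where "A n = {y \<in> space M. \<forall>k. emeasure M (?D y ((1 / 2) ^ k)) \<le> ennreal (real n * ((1 / 2) ^ k) powr t)}" for n :: nat
    have [measurable]: "(\<lambda>y. emeasure M (?D y r)) \<in> borel_measurable M" for r
      using measurable_emeasure_sublevel[OF sigma_finite_measure_axioms _ space, of "\<lambda>q. \<bar>f (snd q) - f (fst q)\<bar>" M r]
      by simp
    have A: "A n \<in> sets M" for n unfolding A_def by measurable
    have "\<exists>n. emeasure M (A n \<inter> S) \<noteq> 0"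
    proof (rule ccontr)
      assume "\<not> (\<exists>n. emeasure M (A n \<inter> S) \<noteq> 0)"
      then have "(\<Union>n. A n \<inter> S) \<in> null_sets M" using A S by (intro null_sets_UN) (auto simp: null_sets_def)
      then have "AE y in M. y \<notin> (\<Union>n. A n \<inter> S)" by (rule AE_not_in)
      with loc S(2) have "AE y in M. False"
      proof eventually_elim
        case (elim y)
        then obtain K where K: "K \<ge> 0" "\<And>k. emeasure M (?D y ((1 / 2) ^ k)) \<le> ennreal (K * ((1 / 2) ^ k) powr t)" by auto
        obtain n :: nat where n: "K \<le> real n" using real_arch_simple by blast
        have "y \<in> A n"
          unfolding A_def using n by (auto simp: space intro!: order_trans[OF K(2)] ennreal_leI mult_right_mono)
        then show ?case using elim by auto
      qed
      then show False by simp
    qed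
    then obtain n where n: "emeasure M (A n \<inter> S) \<noteq> 0" by blast
    define c where "c = measure M (A n \<inter> S)"
    have c: "emeasure M (A n \<inter> S) = ennreal c" "c > 0"
      using n by (auto simp: c_def emeasure_eq_measure zero_less_measure_iff)
    define K where "K = real n * 2 powr t + 1"
    have K: "K > 0" by (simp add: K_def add_nonneg_pos)
    have "hausdorff_premeasure 1 s (f ` S) = 0"
    proof -
      have "hausdorff_premeasure 1 s (f ` S) \<le> hausdorff_measure s (f ` S)"
        unfolding hausdorff_measure_def by (rule SUP_upper) simp
      then show ?thesis using s by simp
    qed
    then have "hausdorff_premeasure 1 s (f ` S) < ennreal (c / (2 * K))" using c K by simp
    then obtain U :: "nat \<Rightarrow> real set" where U: "f ` S \<subseteq> (\<Union>i. U i)" "\<And>i. bounded (U i)" "\<And>i. diameter (U i) \<le> 1"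
      and small: "(\<Sum>i. hausdorff_weight s (U i)) < ennreal (c / (2 * K))"
      unfolding hausdorff_premeasure_def INF_less_iff by auto
    have "\<exists>D. D \<in> sets M \<and> {y \<in> A n \<inter> S. f y \<in> U i} \<subseteq> D \<and> emeasure M D \<le> ennreal K * hausdorff_weight s (U i)" for i
    proof (cases "{y \<in> A n \<inter> S. f y \<in> U i} = {}")
      case True
      then show ?thesis by (intro exI[of _ "{}"]) simp
    next
      case False
      then obtain y where y: "y \<in> A n" "f y \<in> U i" by auto
      define d where "d = diameter (U i)"
      have d: "0 \<le> d" "d \<le> 1" using U by (auto simp: d_def diameter_ge_0)
      have "emeasure M (?D y d) \<le> ennreal (real n * 2 powr t * d powr t)"
        using y d t unfolding A_def
        by (intro emeasure_le_powr_of_dyadic[of "\<lambda>r. emeasure M (?D y r)"] emeasure_mono meas) auto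
      also have "\<dots> \<le> ennreal (K * rpow d s)"
      proof (intro ennreal_leI mult_mono)
        show "d powr t \<le> rpow d s"
        proof (cases "s = 0")
          case True
          then show ?thesis using powr_mono2[of t d 1] d t by (simp add: rpow_def)
        next
          case False
          then show ?thesis using powr_mono'[of s t d] d st by (simp add: rpow_def)
        qed
      qed (use K in \<open>auto simp: K_def\<close>)
      also have "\<dots> = ennreal K * hausdorff_weight s (U i)"
        using y K by (auto simp: hausdorff_weight_def d_def ennreal_mult' rpow_def)
      finally have "emeasure M (?D y d) \<le> ennreal K * hausdorff_weight s (U i)" .
      moreover have "{y \<in> A n \<inter> S. f y \<in> U i} \<subseteq> ?D y d"
        using diameter_bounded_bound[OF U(2), of _ i "f y"] y by (auto simp: d_def dist_real_def)
      ultimately show ?thesis using meas by blast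
    qed
    then obtain D where D: "\<And>i. D i \<in> sets M" "\<And>i. {y \<in> A n \<inter> S. f y \<in> U i} \<subseteq> D i"
      "\<And>i. emeasure M (D i) \<le> ennreal K * hausdorff_weight s (U i)" by metis
    have "ennreal c \<le> emeasure M (\<Union>i. D i)"
      unfolding c(1)[symmetric] using U(1) D(1,2) by (intro emeasure_mono) blast+
    also have "\<dots> \<le> (\<Sum>i. emeasure M (D i))"
      using D(1) by (intro emeasure_subadditive_countably) auto
    also have "\<dots> \<le> (\<Sum>i. ennreal K * hausdorff_weight s (U i))"
      by (intro suminf_le allI D(3)) auto
    also have "\<dots> = ennreal K * (\<Sum>i. hausdorff_weight s (U i))" by simp
    also have "\<dots> \<le> ennreal K * ennreal (c / (2 * K))"
      using small by (intro mult_left_mono) auto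
    also have "\<dots> = ennreal (c / 2)"
      using K c by (simp add: ennreal_mult'[symmetric])
    finally show False using c by (simp add: ennreal_le_iff)
  qed
  then show "ereal t \<le> u" using s by simp
qed

section \<open>Pinned distance sets\<close>

lemma measure_supp_closed: "closed (measure_supp M)"
proof -
  have "- measure_supp M = \<Union>{U. open U \<and> emeasure M U = 0}"
    by (auto simp: measure_supp_def zero_less_iff_neq_zero)
  then show ?thesis unfolding closed_def by (simp add: open_Union)
qed

text \<open>The complement of the support is a union of open null sets, and by the Lindelof property
  countably many of them suffice.\<close>

lemma AE_measure_supp:
  fixes M :: "'a::second_countable_topology measure"
  assumes sets: "sets M = sets borel"
  shows "AE x in M. x \<in> measure_supp M"
proof -
  define \<F> where "\<F> = {U. open U \<and> emeasure M U = 0}"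
  obtain \<F>' where F': "\<F>' \<subseteq> \<F>" "countable \<F>'" "\<Union>\<F>' = \<Union>\<F>"
    using Lindelof[of \<F>] by (auto simp: \<F>_def)
  have "\<Union>\<F>' \<in> null_sets M"
    using F' sets by (intro null_sets_UN'[of \<F>' "\<lambda>U. U", simplified]) (auto simp: \<F>_def null_sets_def)
  moreover have "- measure_supp M = \<Union>\<F>"
    by (auto simp: measure_supp_def zero_less_iff_neq_zero \<F>_def)
  ultimately have "- measure_supp M \<in> null_sets M" using F' by simp
  then show ?thesis by (rule AE_not_in[THEN AE_mp]) auto
qed

lemma AE_pinned_distance_dim_ge:
  fixes M :: "'a::euclidean_space measure"
  assumes M: "prob_space M" and sets [measurable_cong]: "sets M = sets borel"
    and supp: "compact (measure_supp M)"
    and C: "C \<ge> 0" "\<And>\<tau>. \<tau> \<ge> 1 \<Longrightarrow> (\<integral>\<^sup>+z. ennreal (cmod (fourier_measure M (\<tau> *\<^sub>R z))) \<partial>difference_measure M)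
      \<le> ennreal (C * \<tau> powr (- t))"
    and s: "0 < s" "s < t" "s < 1"
  shows "AE x in M. ereal s \<le> hausdorff_dim (pinned_distance_set x (measure_supp M))"
proof -
  obtain R where R: "\<And>x. x \<in> measure_supp M \<Longrightarrow> norm x \<le> R"
    using compact_imp_bounded[OF supp] by (auto simp: bounded_iff)
  have AER: "AE x in M. norm x \<le> R"
    using AE_measure_supp[OF sets] by eventually_elim (rule R)
  have space: "space M = UNIV" using sets_eq_imp_space_eq[OF sets] by simp
  define t' where "t' = (s + min t 1) / 2"
  have t': "s < t'" "t' < 1" "t' \<le> t" "0 < t'" using s by (auto simp: t'_def)
  have C': "(\<integral>\<^sup>+z. ennreal (cmod (fourier_measure M (\<tau> *\<^sub>R z))) \<partial>difference_measure M) \<le> ennreal (C * \<tau> powr (- t'))"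
    if "\<tau> \<ge> 1" for \<tau>
    using that C(1) t' by (intro order_trans[OF C(2)] ennreal_leI mult_left_mono powr_mono) auto
  obtain C2 where C2: "C2 \<ge> 0" "\<And>r. r > 0 \<Longrightarrow> (\<integral>\<^sup>+x. \<integral>\<^sup>+y. emeasure M {y'. \<bar>(dist x y)\<^sup>2 - (dist x y')\<^sup>2\<bar> \<le> r} \<partial>M \<partial>M)
            \<le> ennreal (C2 * r powr t')"
    using distance_small_scale_average[OF M sets C(1) C' t'(4,2)] by blast
  have "AE x in M. AE y in M. \<exists>K\<ge>0. \<forall>k. emeasure M {y'. \<bar>dist x y' - dist x y\<bar> \<le> (1 / 2) ^ k} \<le> ennreal (K * ((1 / 2) ^ k) powr s)"
    by (rule AE_distance_local_dimension[OF M sets AER C2 s(1) t'(1)])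
  then show ?thesis
  proof eventually_elim
    case (elim x)
    have "ereal s \<le> hausdorff_dim (dist x ` measure_supp M)"
      by (rule hausdorff_dim_ge_of_local_dimension[OF M _ space _ AE_measure_supp[OF sets] elim s(1)])
        (auto simp: sets measure_supp_closed)
    also have "dist x ` measure_supp M = pinned_distance_set x (measure_supp M)"
      by (auto simp: pinned_distance_set_def)
    finally show ?case .
  qed
qed

lemma hausdorff_dim_nonneg: "0 \<le> hausdorff_dim E"
  unfolding hausdorff_dim_def by (rule Inf_greatest) auto

text \<open>Rational exponents suffice, and countably many null sets may be discarded.\<close>

lemma AE_hausdorff_dim_ge_of_less:
  fixes \<beta> :: ereal and E :: "'b \<Rightarrow> 'a::metric_space set"
  assumes less: "\<And>s. 0 < s \<Longrightarrow> ereal s < \<beta> \<Longrightarrow> AE x in M. ereal s \<le> hausdorff_dim (E x)"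
  shows "AE x in M. \<beta> \<le> hausdorff_dim (E x)"
proof -
  have "AE x in M. \<forall>q::rat. 0 < q \<longrightarrow> ereal (of_rat q) < \<beta> \<longrightarrow> ereal (of_rat q) \<le> hausdorff_dim (E x)"
    unfolding AE_all_countable using less by auto
  then show ?thesis
  proof eventually_elim
    case (elim x)
    show ?case
    proof (rule ccontr)
      assume "\<not> \<beta> \<le> hausdorff_dim (E x)"
      then have "hausdorff_dim (E x) < \<beta>" by simp
      then obtain a where a: "hausdorff_dim (E x) < ereal a" "ereal a < \<beta>" using ereal_dense2 by blast
      then obtain b where b: "ereal a < ereal b" "ereal b < \<beta>" using ereal_dense2 by blast
      then have "a < b" by simp
      then obtain q where q: "a < of_rat q" "of_rat q < b" using of_rat_dense by blast
      have "0 < a" using a(1) hausdorff_dim_nonneg[of "E x"] by (metis ereal_less(2) order_le_less_trans)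
      then have "0 < (of_rat q :: real)" using q by linarith
      then have "0 < q" by simp
      moreover have "ereal (of_rat q) < \<beta>" using q b by (meson ereal_less_eq(3) le_less_trans less_imp_le)
      ultimately have "ereal (of_rat q) \<le> hausdorff_dim (E x)" using elim by blast
      then show False using a q by (meson ereal_less_eq(3) le_less_trans less_imp_le not_le)
    qed
  qed
qed

lemma fourier_spectrum_witness:
  assumes "ereal u < fourier_spectrum \<theta> M" "0 \<le> u"
  obtains s where "s \<ge> 0" "fourier_energy s \<theta> M < \<infinity>" "u < s"
  using assms unfolding fourier_spectrum_def less_Sup_iff by (auto simp: ereal_less)

lemma ennpow_finite: "ennpow a \<theta> < \<infinity> \<Longrightarrow> a < \<infinity>"
  by (auto simp: ennpow_def less_top split: if_splits)

theorem corollary2p7: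
  fixes \<mu> :: "(real ^ 'd) measure"
  assumes "CARD('d) \<ge> 4"
    and "prob_space \<mu>"
    and "sets \<mu> = sets borel"
    and "compact (measure_supp \<mu>)"
  shows "(AE x in \<mu>. hausdorff_dim (pinned_distance_set x (measure_supp \<mu>))
            \<ge> min (sobolev_dim \<mu> - ereal (real CARD('d) / 2)) 1)
       \<and> (AE x in \<mu>. hausdorff_dim (pinned_distance_set x (measure_supp \<mu>))
            \<ge> min (fourier_spectrum (1/2) \<mu> - ereal (real CARD('d) / 4)) 1)
       \<and> (AE x in \<mu>. hausdorff_dim (pinned_distance_set x (measure_supp \<mu>))
            \<ge> min (fourier_dim \<mu> / 2) 1)"
proof (intro conjI)
  let ?d = "real CARD('d)"
  note M = assms(2) and sets = assms(3) and supp = assms(4)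
  have d: "?d \<ge> 4" using assms(1) by simp
  obtain R where R: "\<And>x. x \<in> measure_supp \<mu> \<Longrightarrow> norm x \<le> R"
    using compact_imp_bounded[OF supp] by (auto simp: bounded_iff)
  have AER: "AE x in \<mu>. norm x \<le> R"
    using AE_measure_supp[OF sets] by eventually_elim (rule R)
  show "AE x in \<mu>. min (sobolev_dim \<mu> - ereal (?d / 2)) 1 \<le> hausdorff_dim (pinned_distance_set x (measure_supp \<mu>))"
  proof (rule AE_hausdorff_dim_ge_of_less)
    fix u :: real assume u: "0 < u" "ereal u < min (sobolev_dim \<mu> - ereal (?d / 2)) 1"
    then have "ereal (u + ?d / 2) < fourier_spectrum 1 \<mu>"
      by (cases "fourier_spectrum 1 \<mu>") (auto simp: sobolev_dim_def)
    then obtain s where s: "fourier_energy s 1 \<mu> < \<infinity>" "u + ?d / 2 < s"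
      using u by (elim fourier_spectrum_witness) auto
    have "(\<integral>\<^sup>+v. ennreal ((cmod (fourier_measure \<mu> v))\<^sup>2 * norm v powr (s - real DIM(real ^ 'd))) \<partial>lborel) < \<infinity>"
      using ennpow_finite s(1) by (auto simp: fourier_energy_def)
    from fourier_average_decay_sobolev[OF M sets AER this]
    obtain C where C: "C \<ge> 0" "\<And>\<tau>. \<tau> \<ge> 1 \<Longrightarrow> (\<integral>\<^sup>+z. ennreal (cmod (fourier_measure \<mu> (\<tau> *\<^sub>R z))) \<partial>difference_measure \<mu>)
      \<le> ennreal (C * \<tau> powr (- (min s ?d - ?d / 2)))" by auto
    show "AE x in \<mu>. ereal u \<le> hausdorff_dim (pinned_distance_set x (measure_supp \<mu>))"
      by (rule AE_pinned_distance_dim_ge[OF M sets supp C]) (use u s d in auto)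
  qed
  show "AE x in \<mu>. min (fourier_spectrum (1/2) \<mu> - ereal (?d / 4)) 1 \<le> hausdorff_dim (pinned_distance_set x (measure_supp \<mu>))"
  proof (rule AE_hausdorff_dim_ge_of_less)
    fix u :: real assume u: "0 < u" "ereal u < min (fourier_spectrum (1/2) \<mu> - ereal (?d / 4)) 1"
    then have "ereal (u + ?d / 4) < fourier_spectrum (1/2) \<mu>"
      by (cases "fourier_spectrum (1/2) \<mu>") auto
    then obtain s where s: "fourier_energy s (1/2) \<mu> < \<infinity>" "u + ?d / 4 < s"
      using u by (elim fourier_spectrum_witness) auto
    have "(\<integral>\<^sup>+v. ennreal ((cmod (fourier_measure \<mu> v)) ^ 4 * norm v powr (2 * s - real DIM(real ^ 'd))) \<partial>lborel) < \<infinity>"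
      using ennpow_finite s(1) by (auto simp: fourier_energy_def mult.commute)
    from fourier_average_decay_fourth[OF M sets AER this]
    obtain C where C: "C \<ge> 0" "\<And>\<tau>. \<tau> \<ge> 1 \<Longrightarrow> (\<integral>\<^sup>+z. ennreal (cmod (fourier_measure \<mu> (\<tau> *\<^sub>R z))) \<partial>difference_measure \<mu>)
      \<le> ennreal (C * \<tau> powr (- (min s (?d / 2) - ?d / 4)))" by auto
    show "AE x in \<mu>. ereal u \<le> hausdorff_dim (pinned_distance_set x (measure_supp \<mu>))"
      by (rule AE_pinned_distance_dim_ge[OF M sets supp C]) (use u s d in auto)
  qed
  show "AE x in \<mu>. min (fourier_dim \<mu> / 2) 1 \<le> hausdorff_dim (pinned_distance_set x (measure_supp \<mu>))"
  proof (rule AE_hausdorff_dim_ge_of_less)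
    fix u :: real assume u: "0 < u" "ereal u < min (fourier_dim \<mu> / 2) 1"
    then have "ereal (2 * u) < fourier_spectrum 0 \<mu>"
      by (cases "fourier_spectrum 0 \<mu>") (auto simp: fourier_dim_def)
    then obtain s where s: "fourier_energy s 0 \<mu> < \<infinity>" "2 * u < s"
      using u by (elim fourier_spectrum_witness) auto
    define J where "J = enn2real (fourier_energy s 0 \<mu>)"
    have J: "(cmod (fourier_measure \<mu> z))\<^sup>2 * rpow (norm z) s \<le> J" for z
    proof -
      have "ennreal ((cmod (fourier_measure \<mu> z))\<^sup>2 * rpow (norm z) s) \<le> fourier_energy s 0 \<mu>"
        using SUP_upper[of z UNIV "\<lambda>z. ennreal ((cmod (fourier_measure \<mu> z))\<^sup>2 * rpow (norm z) s)"]
        by (simp add: fourier_energy_def)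
      also have "\<dots> = ennreal J" using s by (simp add: J_def)
      finally show ?thesis by (simp add: J_def)
    qed
    \<comment> \<open>The decay lemma wants an exponent below 1, and the dimension bound one above \<open>u\<close>.\<close>
    define t where "t = (u + min 1 (s / 2)) / 2"
    have t: "u < t" "t < 1" "2 * t \<le> s" "0 < t" using u s by (auto simp: t_def)
    obtain C where C: "C \<ge> 0" "\<And>\<tau>. \<tau> \<ge> 1 \<Longrightarrow> (\<integral>\<^sup>+z. ennreal (cmod (fourier_measure \<mu> (\<tau> *\<^sub>R z))) \<partial>difference_measure \<mu>)
      \<le> ennreal (C * \<tau> powr (- t))"
      using fourier_average_decay_pointwise[OF M sets J t(4,2,3)] by auto
    show "AE x in \<mu>. ereal u \<le> hausdorff_dim (pinned_distance_set x (measure_supp \<mu>))"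
      by (rule AE_pinned_distance_dim_ge[OF M sets supp C]) (use u t in auto)
  qed
qed

end
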